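(* The problem $\mathrm{PartSynth}(\mathrm{FO}^2[\sim,+1])$ is undecidable; that is, there is no algorithm which, given a finite alphabet $A=A_S\uplus A_E$ of actions and a sentence $\varphi\in\mathrm{FO}^2[\sim,+1]$ over $A$, decides whether there exist finite disjoint sets of processes $\mathbb{P}_S$ and $\mathbb{P}_E$ (with no shared processes) such that System has a winning strategy for $\varphi$.
   Context: **Data words.** $A$ is a finite alphabet of actions, partitioned into System actions $A_S$ and Environment actions $A_E$. Processes are partitioned between the players: $\mathbb{P}_S$ (System processes) and $\mathbb{P}_E$ (Environment processes) are disjoint finite sets, and there is no shared process. Let $\Sigma_S := A_S\times\mathbb{P}_S$, $\Sigma_E := A_E\times\mathbb{P}_E$, $\Sigma:=\Sigma_S\cup\Sigma_E$. A data word is a finite or infinite sequence $w=(a_0,p_0)(a_1,p_1)\cdots$ over $\Sigma$; each pair $(a_i,p_i)$ in the sequence is called a position. **Logic.** Formulas of $\mathrm{FO}^2[\sim,+1]$ are first-order formulas (connectives $\neg,\land,\lor,\exists,\forall$) using only two (reusable) variables $x,y$, built from the atoms $a(x)$ for $a\in A$, $x=y$, $x=y+1$, $x\sim y$, $\mathbb{P}_S(x)$, $\mathbb{P}_E(x)$ (and $\mathbb{P}_{SE}(x)$, for shared processes, which is interpreted as the empty set here), up to renaming of the two variables; the order $<$ is not available. A data word is represented as a structure whose domain has one element for each position and one element for each process in $\mathbb{P}_S\cup\mathbb{P}_E$ (including processes on which no action is played). $\mathbb{P}_S$ (resp. $\mathbb{P}_E$) is interpreted as the set of process elements of System (resp.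 Environment); $a$ is interpreted as the set of positions whose action is $a$; $+1$ is the successor relation of the linear order on positions ($x=y+1$ holds iff $x$ is the position immediately following position $y$); $\sim$ is the equivalence relation such that two positions $(a_i,p_i)$, $(a_j,p_j)$ are related iff $p_i=p_j$, and each process element $p$ is related to all positions of the form $(a,p)$. **Strategies.** A strategy for System is a function $\mathcal{S}:\Sigma^*\to\Sigma_S\cup\{\varepsilon\}$. An execution (data word) $w=\sigma_0\sigma_1\cdots$ is $\mathcal{S}$-compatible if (i) for all $0\le i<|w|$, $\sigma_i\in\Sigma_S$ implies $\sigma_i=\mathcal{S}(\sigma_0\cdots\sigma_{i-1})$, and (ii) if $w$ is finite then $\mathcal{S}(w)=\varepsilon$. It is fair for $\mathcal{S}$ if, whenever there are infinitely many $i$ with $\mathcal{S}(\sigma_0\cdots\sigma_{i-1})\neq\varepsilon$, there are infinitely many positions of $w$ in $\Sigma_S$. $\mathcal{S}$ is winning for $\varphi$ if all executions that are $\mathcal{S}$-compatible and fair for $\mathcal{S}$ satisfy $\varphi$. **Problem.** For a logic $\mathcal{L}$, $\mathrm{PartSynth}(\mathcal{L})$ is the problem: given $A=A_S\uplus A_E$ and a sentence $\varphi\in\mathcal{L}$, decide whether System has a winning strategy for $\varphi$ for some arbitrary finite sets $\mathbb{P}_S$ and $\mathbb{P}_E$ (no shared processes). *)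

theory Defs
  imports "HOL-Library.Nat_Bijection"
begin

datatype 'c seq = FinSeq "'c list" | InfSeq "nat \<Rightarrow> 'c"

fun positions :: "'c seq \<Rightarrow> nat set" where
  "positions (FinSeq u) = {..<length u}"
| "positions (InfSeq s) = UNIV"

fun letter_at :: "'c seq \<Rightarrow> nat \<Rightarrow> 'c" where
  "letter_at (FinSeq u) i = u ! i"
| "letter_at (InfSeq s) i = s i"

definition pref :: "'c seq \<Rightarrow> nat \<Rightarrow> 'c list" where
  "pref w i = map (letter_at w) [0..<i]"

type_synonym ('a, 'p) letter = "'a \<times> 'p"
type_synonym ('a, 'p) dataword = "('a, 'p) letter seq"

definition data_words ::
  "'a set \<Rightarrow> 'a set \<Rightarrow> 'p set \<Rightarrow> 'p set \<Rightarrow> ('a, 'p) dataword set" where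
  "data_words A\<^sub>S A\<^sub>E P\<^sub>S P\<^sub>E =
     {w. \<forall>i \<in> positions w. letter_at w i \<in> A\<^sub>S \<times> P\<^sub>S \<union> A\<^sub>E \<times> P\<^sub>E}"

datatype var = Vx | Vy

(* Suc_of x y stands for the atom x = y + 1. *)
datatype 'a fo2 =
    Act 'a var
  | Eq var var
  | Suc_of var var
  | Sim var var
  | Sys var
  | Env var
  | Shared var
  | Neg "'a fo2"
  | Conj "'a fo2" "'a fo2"
  | Disj "'a fo2" "'a fo2"
  | Exists var "'a fo2"
  | Forall var "'a fo2"

fun free_vars :: "'a fo2 \<Rightarrow> var set" where
  "free_vars (Act a x) = {x}"
| "free_vars (Eq x y) = {x, y}"
| "free_vars (Suc_of x y) = {x, y}"
| "free_vars (Sim x y) = {x, y}"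
| "free_vars (Sys x) = {x}"
| "free_vars (Env x) = {x}"
| "free_vars (Shared x) = {x}"
| "free_vars (Neg \<phi>) = free_vars \<phi>"
| "free_vars (Conj \<phi> \<psi>) = free_vars \<phi> \<union> free_vars \<psi>"
| "free_vars (Disj \<phi> \<psi>) = free_vars \<phi> \<union> free_vars \<psi>"
| "free_vars (Exists x \<phi>) = free_vars \<phi> - {x}"
| "free_vars (Forall x \<phi>) = free_vars \<phi> - {x}"

definition sentences :: "'a set \<Rightarrow> 'a fo2 set" where
  "sentences A = {\<phi>. free_vars \<phi> = {} \<and> set_fo2 \<phi> \<subseteq> A}"

datatype 'p elem = Pos nat | Proc 'p

definition dom_of :: "'p set \<Rightarrow> 'p set \<Rightarrow> ('a, 'p) dataword \<Rightarrow> 'p elem set" where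
  "dom_of P\<^sub>S P\<^sub>E w = Pos ` positions w \<union> Proc ` (P\<^sub>S \<union> P\<^sub>E)"

(* The classes of the relation \<sim> are the fibres of this map. *)
fun process :: "('a, 'p) dataword \<Rightarrow> 'p elem \<Rightarrow> 'p" where
  "process w (Pos i) = snd (letter_at w i)"
| "process w (Proc p) = p"

fun sat ::
  "'p set \<Rightarrow> 'p set \<Rightarrow> ('a, 'p) dataword \<Rightarrow> (var \<Rightarrow> 'p elem) \<Rightarrow> 'a fo2 \<Rightarrow> bool" where
  "sat P\<^sub>S P\<^sub>E w \<nu> (Act a x) \<longleftrightarrow> (\<exists>i \<in> positions w. \<nu> x = Pos i \<and> fst (letter_at w i) = a)"
| "sat P\<^sub>S P\<^sub>E w \<nu> (Eq x y) \<longleftrightarrow> \<nu> x = \<nu> y"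
| "sat P\<^sub>S P\<^sub>E w \<nu> (Suc_of x y) \<longleftrightarrow> (\<exists>i. \<nu> y = Pos i \<and> \<nu> x = Pos (Suc i))"
| "sat P\<^sub>S P\<^sub>E w \<nu> (Sim x y) \<longleftrightarrow> process w (\<nu> x) = process w (\<nu> y)"
| "sat P\<^sub>S P\<^sub>E w \<nu> (Sys x) \<longleftrightarrow> \<nu> x \<in> Proc ` P\<^sub>S"
| "sat P\<^sub>S P\<^sub>E w \<nu> (Env x) \<longleftrightarrow> \<nu> x \<in> Proc ` P\<^sub>E"
| "sat P\<^sub>S P\<^sub>E w \<nu> (Shared x) \<longleftrightarrow> False"
| "sat P\<^sub>S P\<^sub>E w \<nu> (Neg \<phi>) \<longleftrightarrow> \<not> sat P\<^sub>S P\<^sub>E w \<nu> \<phi>"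
| "sat P\<^sub>S P\<^sub>E w \<nu> (Conj \<phi> \<psi>) \<longleftrightarrow> sat P\<^sub>S P\<^sub>E w \<nu> \<phi> \<and> sat P\<^sub>S P\<^sub>E w \<nu> \<psi>"
| "sat P\<^sub>S P\<^sub>E w \<nu> (Disj \<phi> \<psi>) \<longleftrightarrow> sat P\<^sub>S P\<^sub>E w \<nu> \<phi> \<or> sat P\<^sub>S P\<^sub>E w \<nu> \<psi>"
| "sat P\<^sub>S P\<^sub>E w \<nu> (Exists x \<phi>) \<longleftrightarrow> (\<exists>d \<in> dom_of P\<^sub>S P\<^sub>E w. sat P\<^sub>S P\<^sub>E w (\<nu>(x := d)) \<phi>)"
| "sat P\<^sub>S P\<^sub>E w \<nu> (Forall x \<phi>) \<longleftrightarrow> (\<forall>d \<in> dom_of P\<^sub>S P\<^sub>E w. sat P\<^sub>S P\<^sub>E w (\<nu>(x := d)) \<phi>)"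

lemma sat_cong_free_vars:
  "(\<And>x. x \<in> free_vars \<phi> \<Longrightarrow> \<nu> x = \<mu> x) \<Longrightarrow> sat P\<^sub>S P\<^sub>E w \<nu> \<phi> \<longleftrightarrow> sat P\<^sub>S P\<^sub>E w \<mu> \<phi>"
proof (induction \<phi> arbitrary: \<nu> \<mu>)
  case (Neg \<phi>)
  then show ?case by (metis free_vars.simps(8) sat.simps(8))
next
  case (Conj \<phi> \<psi>)
  then show ?case by (metis UnCI free_vars.simps(9) sat.simps(9))
next
  case (Disj \<phi> \<psi>)
  then show ?case by (metis UnCI free_vars.simps(10) sat.simps(10))
next
  case (Exists x \<phi>)
  have "sat P\<^sub>S P\<^sub>E w (\<nu>(x := d)) \<phi> \<longleftrightarrow> sat P\<^sub>S P\<^sub>E w (\<mu>(x := d)) \<phi>" for d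
    by (rule Exists.IH) (use Exists.prems in auto)
  then show ?case by simp
next
  case (Forall x \<phi>)
  have "sat P\<^sub>S P\<^sub>E w (\<nu>(x := d)) \<phi> \<longleftrightarrow> sat P\<^sub>S P\<^sub>E w (\<mu>(x := d)) \<phi>" for d
    by (rule Forall.IH) (use Forall.prems in auto)
  then show ?case by simp
qed auto

(* For a sentence the choice of valuation is immaterial (sat_cong_free_vars). Valuations are not
   restricted to dom_of, which is empty for the empty word without processes. *)
definition models :: "'p set \<Rightarrow> 'p set \<Rightarrow> ('a, 'p) dataword \<Rightarrow> 'a fo2 \<Rightarrow> bool" where
  "models P\<^sub>S P\<^sub>E w \<phi> \<longleftrightarrow> (\<forall>\<nu>. sat P\<^sub>S P\<^sub>E w \<nu> \<phi>)"

(* None is the output \<epsilon>. *)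
type_synonym ('a, 'p) strategy = "('a, 'p) letter list \<Rightarrow> ('a, 'p) letter option"

definition strategies ::
  "'a set \<Rightarrow> 'a set \<Rightarrow> 'p set \<Rightarrow> 'p set \<Rightarrow> ('a, 'p) strategy set" where
  "strategies A\<^sub>S A\<^sub>E P\<^sub>S P\<^sub>E =
     {S. \<forall>u \<in> lists (A\<^sub>S \<times> P\<^sub>S \<union> A\<^sub>E \<times> P\<^sub>E). S u \<in> insert None (Some ` (A\<^sub>S \<times> P\<^sub>S))}"

definition compatible ::
  "'a set \<Rightarrow> 'p set \<Rightarrow> ('a, 'p) strategy \<Rightarrow> ('a, 'p) dataword \<Rightarrow> bool" where
  "compatible A\<^sub>S P\<^sub>S S w \<longleftrightarrow>
     (\<forall>i \<in> positions w. letter_at w i \<in> A\<^sub>S \<times> P\<^sub>S \<longrightarrow> S (pref w i) = Some (letter_at w i)) \<and>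
     (\<forall>u. w = FinSeq u \<longrightarrow> S u = None)"

definition fair ::
  "'a set \<Rightarrow> 'p set \<Rightarrow> ('a, 'p) strategy \<Rightarrow> ('a, 'p) dataword \<Rightarrow> bool" where
  "fair A\<^sub>S P\<^sub>S S w \<longleftrightarrow>
     (infinite {i \<in> positions w. S (pref w i) \<noteq> None} \<longrightarrow>
      infinite {i \<in> positions w. letter_at w i \<in> A\<^sub>S \<times> P\<^sub>S})"

definition winning ::
  "'a set \<Rightarrow> 'a set \<Rightarrow> 'p set \<Rightarrow> 'p set \<Rightarrow> ('a, 'p) strategy \<Rightarrow> 'a fo2 \<Rightarrow> bool" where
  "winning A\<^sub>S A\<^sub>E P\<^sub>S P\<^sub>E S \<phi> \<longleftrightarrow>
     (\<forall>w \<in> data_words A\<^sub>S A\<^sub>E P\<^sub>S P\<^sub>E.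
        compatible A\<^sub>S P\<^sub>S S w \<and> fair A\<^sub>S P\<^sub>S S w \<longrightarrow> models P\<^sub>S P\<^sub>E w \<phi>)"

(* Up to renaming of processes, all finite sets of processes are sets of natural numbers. *)
definition part_synth :: "'a set \<Rightarrow> 'a set \<Rightarrow> 'a fo2 \<Rightarrow> bool" where
  "part_synth A\<^sub>S A\<^sub>E \<phi> \<longleftrightarrow>
     (\<exists>(P\<^sub>S :: nat set) (P\<^sub>E :: nat set). finite P\<^sub>S \<and> finite P\<^sub>E \<and> P\<^sub>S \<inter> P\<^sub>E = {} \<and>
        (\<exists>S \<in> strategies A\<^sub>S A\<^sub>E P\<^sub>S P\<^sub>E. winning A\<^sub>S A\<^sub>E P\<^sub>S P\<^sub>E S \<phi>))"

(* Programs carry no arity: Zr, Proj, Comp and Mu accept argument lists of any (sufficient) length.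
   Restricting a program to lists of length n gives a partial recursive n-ary function, and every
   such function arises this way. *)
datatype recf = Zr | Sc | Proj nat | Comp recf "recf list" | PrimRec recf recf | Mu recf

inductive rec_eval :: "recf \<Rightarrow> nat list \<Rightarrow> nat \<Rightarrow> bool" where
  eval_Zr: "rec_eval Zr xs 0"
| eval_Sc: "rec_eval Sc [x] (Suc x)"
| eval_Proj: "i < length xs \<Longrightarrow> rec_eval (Proj i) xs (xs ! i)"
| eval_Comp: "list_all2 (\<lambda>g y. rec_eval g xs y) gs ys \<Longrightarrow> rec_eval f ys z \<Longrightarrow>
    rec_eval (Comp f gs) xs z"
| eval_PrimRec_0: "rec_eval f xs z \<Longrightarrow> rec_eval (PrimRec f g) (0 # xs) z"
| eval_PrimRec_Suc: "rec_eval (PrimRec f g) (n # xs) r \<Longrightarrow> rec_eval g (n # r # xs) z \<Longrightarrow>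
    rec_eval (PrimRec f g) (Suc n # xs) z"
| eval_Mu: "rec_eval f (n # xs) 0 \<Longrightarrow> \<forall>m < n. \<exists>k. rec_eval f (m # xs) (Suc k) \<Longrightarrow>
    rec_eval (Mu f) xs n"

inductive_cases rec_eval_ZrE: "rec_eval Zr xs z"
  and rec_eval_ScE: "rec_eval Sc xs z"
  and rec_eval_ProjE: "rec_eval (Proj i) xs z"
  and rec_eval_CompE: "rec_eval (Comp f gs) xs z"
  and rec_eval_PrimRec_0E: "rec_eval (PrimRec f g) (0 # xs) z"
  and rec_eval_PrimRec_SucE: "rec_eval (PrimRec f g) (Suc n # xs) z"
  and rec_eval_MuE: "rec_eval (Mu f) xs z"

lemma rec_eval_deterministic: "rec_eval f xs y \<Longrightarrow> rec_eval f xs z \<Longrightarrow> y = z"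
proof (induction arbitrary: z rule: rec_eval.induct)
  case (eval_Zr xs)
  then show ?case by (blast elim: rec_eval_ZrE)
next
  case (eval_Sc x)
  then show ?case by (blast elim: rec_eval_ScE)
next
  case (eval_Proj i xs)
  from eval_Proj.prems show ?case by (rule rec_eval_ProjE) simp
next
  case (eval_Comp xs gs ys f y)
  obtain zs where
    zs: "list_all2 (\<lambda>g y. rec_eval g xs y) gs zs" "rec_eval f zs z"
    using eval_Comp.prems by (rule rec_eval_CompE)
  have "ys = zs"
  proof (rule nth_equalityI)
    show "length ys = length zs"
      using list_all2_lengthD[OF eval_Comp.IH(1)] list_all2_lengthD[OF zs(1)] by (rule trans[OF sym])
    show "ys ! i = zs ! i" if "i < length ys" for i
    proof -
      have "i < length gs"
        using that list_all2_lengthD[OF eval_Comp.IH(1)] by (rule ord_less_eq_trans[OF _ sym])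
      then show ?thesis
        using list_all2_nthD[OF eval_Comp.IH(1)] list_all2_nthD[OF zs(1)] by blast
    qed
  qed
  with zs(2) have "rec_eval f ys z" by simp
  then show ?case by (rule eval_Comp.IH)
next
  case (eval_PrimRec_0 f xs y g)
  from eval_PrimRec_0.prems show ?case
    by (rule rec_eval_PrimRec_0E) (rule eval_PrimRec_0.IH)
next
  case (eval_PrimRec_Suc f g n xs r y)
  obtain r' where "rec_eval (PrimRec f g) (n # xs) r'" "rec_eval g (n # r' # xs) z"
    using eval_PrimRec_Suc.prems by (rule rec_eval_PrimRec_SucE)
  with eval_PrimRec_Suc.IH show ?case by blast
next
  case (eval_Mu f n xs)
  have z: "rec_eval f (z # xs) 0" "\<forall>m < z. \<exists>k. rec_eval f (m # xs) (Suc k)"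
    using eval_Mu.prems by (rule rec_eval_MuE, simp)+
  show ?case
  proof (rule linorder_cases[of n z])
    assume "n < z"
    with z(2) obtain k where "rec_eval f (n # xs) (Suc k)" by blast
    then show ?thesis by (blast dest: eval_Mu.IH(1))
  next
    assume "z < n"
    with eval_Mu.IH(2) z(1) show ?thesis by blast
  qed simp
qed

fun var_encode :: "var \<Rightarrow> nat" where
  "var_encode Vx = 0"
| "var_encode Vy = 1"

fun fo2_encode :: "nat fo2 \<Rightarrow> nat" where
  "fo2_encode (Act a x) = prod_encode (0, prod_encode (a, var_encode x))"
| "fo2_encode (Eq x y) = prod_encode (1, prod_encode (var_encode x, var_encode y))"
| "fo2_encode (Suc_of x y) = prod_encode (2, prod_encode (var_encode x, var_encode y))"
| "fo2_encode (Sim x y) = prod_encode (3, prod_encode (var_encode x, var_encode y))"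
| "fo2_encode (Sys x) = prod_encode (4, var_encode x)"
| "fo2_encode (Env x) = prod_encode (5, var_encode x)"
| "fo2_encode (Shared x) = prod_encode (6, var_encode x)"
| "fo2_encode (Neg \<phi>) = prod_encode (7, fo2_encode \<phi>)"
| "fo2_encode (Conj \<phi> \<psi>) = prod_encode (8, prod_encode (fo2_encode \<phi>, fo2_encode \<psi>))"
| "fo2_encode (Disj \<phi> \<psi>) = prod_encode (9, prod_encode (fo2_encode \<phi>, fo2_encode \<psi>))"
| "fo2_encode (Exists x \<phi>) = prod_encode (10, prod_encode (var_encode x, fo2_encode \<phi>))"
| "fo2_encode (Forall x \<phi>) = prod_encode (11, prod_encode (var_encode x, fo2_encode \<phi>))"

lemma var_encode_eq: "var_encode x = var_encode y \<longleftrightarrow> x = y"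
  by (cases x; cases y) auto

lemma fo2_encode_eq: "fo2_encode \<phi> = fo2_encode \<psi> \<longleftrightarrow> \<phi> = \<psi>"
proof
  show "fo2_encode \<phi> = fo2_encode \<psi> \<Longrightarrow> \<phi> = \<psi>"
    by (induction \<phi> arbitrary: \<psi>; case_tac \<psi>) (simp_all add: prod_encode_eq var_encode_eq)
qed simp

type_synonym inst = "nat set \<times> nat set \<times> nat fo2"

definition instances :: "inst set" where
  "instances = {(A\<^sub>S, A\<^sub>E, \<phi>). finite A\<^sub>S \<and> finite A\<^sub>E \<and> A\<^sub>S \<inter> A\<^sub>E = {} \<and> \<phi> \<in> sentences (A\<^sub>S \<union> A\<^sub>E)}"

fun inst_encode :: "inst \<Rightarrow> nat" where
  "inst_encode (A\<^sub>S, A\<^sub>E, \<phi>) =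
     prod_encode (set_encode A\<^sub>S, prod_encode (set_encode A\<^sub>E, fo2_encode \<phi>))"

lemma inj_on_inst_encode: "inj_on inst_encode instances"
  by (auto simp: inj_on_def instances_def prod_encode_eq set_encode_eq fo2_encode_eq)

(* The program may behave arbitrarily, and even diverge, on numbers outside enc ` I. *)
definition decidable :: "('i \<Rightarrow> nat) \<Rightarrow> 'i set \<Rightarrow> 'i set \<Rightarrow> bool" where
  "decidable enc I Q \<longleftrightarrow> (\<exists>f. \<forall>i \<in> I. rec_eval f [enc i] (if i \<in> Q then 1 else 0))"

definition PartSynth :: "inst set" where
  "PartSynth = {(A\<^sub>S, A\<^sub>E, \<phi>) \<in> instances. part_synth A\<^sub>S A\<^sub>E \<phi>}"

end

(*
  Diagonalisation over counter machines. System spells out a run of a machine as a word of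
  transition letters; the value of counter r is the number of System processes that carry an
  increment letter of r but no decrement letter of r, each process being used for at most one
  increment and at most one decrement. The logic has no order, but Environment owns a single
  letter "stop" that it may play once at any moment, after which System must remain silent. Hence
  a condition on the whole word, imposed on all plays, is a condition on every prefix of the run:
  "every decrement has an increment on the same process" then says that the increment comes first,
  and "if the stop follows a zero test, every increment is matched" says that the zero test is
  correct. If the machine halts, enough processes allow System to spell out the halting run; if
  not, no number of processes helps.

  The input of the machine is a pair (a, c), written in unary at the beginning of the word and
  demanded by a conjunct of the formula that does not depend on the machine. A decision procedure
  yields a recursive function, hence a machine P, that on input (a, c) halts iff the instance with
  System alphabet coded by a and formula coded by c, conjoined with the demand for input (a, c),
  is negative. Running P on the codes of its own alphabet and formula is contradictory.
*)
theory Submission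
  imports Defs
begin

section \<open>Recursive functions and counter programs\<close>

definition computable :: "nat \<Rightarrow> (nat list \<Rightarrow> nat) \<Rightarrow> bool" where
  "computable k F \<longleftrightarrow> (\<exists>f. \<forall>xs. length xs = k \<longrightarrow> rec_eval f xs (F xs))"

lemma computable_cong:
  assumes "computable k F" "\<And>xs. length xs = k \<Longrightarrow> F xs = G xs"
  shows "computable k G"
  using assms unfolding computable_def by metis

lemma computable_proj: "i < k \<Longrightarrow> computable k (\<lambda>xs. xs ! i)"
  unfolding computable_def using eval_Proj by blast

lemma computable_comp:
  assumes "computable (length Gs) F" "\<forall>G \<in> set Gs. computable k G"
  shows "computable k (\<lambda>xs. F (map (\<lambda>G. G xs) Gs))"
proof -
  obtain f where f: "\<And>xs. length xs = length Gs \<Longrightarrow> rec_eval f xs (F xs)"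
    using assms(1) unfolding computable_def by blast
  have "\<forall>G \<in> set Gs. \<exists>g. \<forall>xs. length xs = k \<longrightarrow> rec_eval g xs (G xs)"
    using assms(2) unfolding computable_def .
  then obtain g where g: "\<And>G xs. G \<in> set Gs \<Longrightarrow> length xs = k \<Longrightarrow> rec_eval (g G) xs (G xs)"
    by metis
  have "rec_eval (Comp f (map g Gs)) xs (F (map (\<lambda>G. G xs) Gs))" if "length xs = k" for xs
    using that by (intro eval_Comp[where ys = "map (\<lambda>G. G xs) Gs"] f) (auto simp: list_all2_conv_all_nth g)
  then show ?thesis unfolding computable_def by blast
qed

lemma computable_Suc: "computable k F \<Longrightarrow> computable k (\<lambda>xs. Suc (F xs))"
proof -
  have "computable 1 (\<lambda>xs. Suc (hd xs))"
    unfolding computable_def by (metis One_nat_def eval_Sc length_0_conv length_Suc_conv list.sel(1))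
  then show "computable k F \<Longrightarrow> ?thesis"
    using computable_comp[of "[F]" "\<lambda>xs. Suc (hd xs)" k] by simp
qed

lemma computable_const: "computable k (\<lambda>xs. c)"
proof (induction c)
  case 0
  then show ?case unfolding computable_def using eval_Zr by blast
qed (rule computable_Suc)

lemma computable_comp2:
  assumes "computable 2 (\<lambda>xs. F (xs ! 0) (xs ! 1))" "computable k G" "computable k H"
  shows "computable k (\<lambda>xs. F (G xs) (H xs))"
  using computable_comp[of "[G, H]" "\<lambda>xs. F (xs ! 0) (xs ! 1)" k] assms
  by (simp add: numeral_2_eq_2)

text \<open>The step function receives recursion index, previous value and parameters in the order
  of \<open>eval_PrimRec_Suc\<close>. With \<open>rec_nat\<close> on the outside, addition,
  \<open>triangle\<close> and iteration become instances.\<close>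

lemma computable_prim_rec:
  assumes "computable k G" "computable (Suc (Suc k)) H"
  shows "computable (Suc k) (\<lambda>xs. rec_nat (G (tl xs)) (\<lambda>n r. H (n # r # tl xs)) (hd xs))"
proof -
  obtain g h where g: "\<And>xs. length xs = k \<Longrightarrow> rec_eval g xs (G xs)"
    and h: "\<And>xs. length xs = Suc (Suc k) \<Longrightarrow> rec_eval h xs (H xs)"
    using assms unfolding computable_def by blast
  have "rec_eval (PrimRec g h) (n # xs) (rec_nat (G xs) (\<lambda>n r. H (n # r # xs)) n)"
    if "length xs = k" for n xs
  proof (induction n)
    case 0
    then show ?case using g[OF that] by (simp add: eval_PrimRec_0)
  next
    case (Suc n)
    show ?case by (rule eval_PrimRec_Suc[OF Suc]) (simp add: h that)
  qed
  then have "\<forall>xs. length xs = Suc k \<longrightarrow>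
      rec_eval (PrimRec g h) xs (rec_nat (G (tl xs)) (\<lambda>n r. H (n # r # tl xs)) (hd xs))"
    by (auto simp: length_Suc_conv)
  then show ?thesis unfolding computable_def by blast
qed

lemma computable_add: "computable k G \<Longrightarrow> computable k H \<Longrightarrow> computable k (\<lambda>xs. G xs + H xs)"
proof (rule computable_comp2[where F = "(+)"])
  have rec: "rec_nat y (\<lambda>_. Suc) x = x + y" for x y by (induction x) auto
  have "computable (Suc (Suc 0)) (\<lambda>xs. xs ! 0 + xs ! 1)"
    by (rule computable_cong[OF computable_prim_rec[of "Suc 0" "\<lambda>xs. xs ! 0" "\<lambda>xs. Suc (xs ! 1)"]])
      (auto simp: length_Suc_conv rec intro!: computable_proj computable_Suc)
  then show "computable 2 (\<lambda>xs. xs ! 0 + xs ! 1)" by (simp only: numeral_2_eq_2)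
qed

lemma computable_triangle: "computable k G \<Longrightarrow> computable k (\<lambda>xs. triangle (G xs))"
proof -
  have rec: "rec_nat 0 (\<lambda>n r. Suc n + r) x = triangle x" for x by (induction x) auto
  have "computable 1 (\<lambda>xs. triangle (xs ! 0))"
    unfolding One_nat_def
    by (rule computable_cong[OF computable_prim_rec[of 0 "\<lambda>xs. 0" "\<lambda>xs. Suc (xs ! 0) + xs ! 1"]])
      (auto simp: length_Suc_conv rec[simplified] intro!: computable_proj computable_Suc computable_add computable_const)
  then show "computable k G \<Longrightarrow> ?thesis"
    using computable_comp[of "[G]" "\<lambda>xs. triangle (xs ! 0)" k] by simp
qed

lemma computable_prod_encode:
  "computable k G \<Longrightarrow> computable k H \<Longrightarrow> computable k (\<lambda>xs. prod_encode (G xs, H xs))"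
  by (simp add: prod_encode_def computable_add computable_triangle)

text \<open>Unary input makes the formula grow with the input, and its code is then an iterate of a
  single function on codes; this closure property makes that code computable.\<close>

lemma computable_funpow:
  assumes "computable k N" "computable k G" "computable 1 (\<lambda>xs. F (xs ! 0))"
  shows "computable k (\<lambda>xs. (F ^^ N xs) (G xs))"
proof (rule computable_comp2[OF _ assms(1,2)])
  have rec: "rec_nat y (\<lambda>_. F) x = (F ^^ x) y" for x y by (induction x) auto
  have "computable (Suc (Suc (Suc 0))) (\<lambda>xs. F (xs ! 1))"
    using computable_comp[of "[\<lambda>xs. xs ! 1]" "\<lambda>xs. F (xs ! 0)" "Suc (Suc (Suc 0))"] assms(3)
    by (simp add: computable_proj)
  then have "computable (Suc (Suc 0)) (\<lambda>xs. rec_nat (tl xs ! 0) (\<lambda>n r. F ((n # r # tl xs) ! 1)) (hd xs))"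
    by (intro computable_prim_rec computable_proj) auto
  then show "computable 2 (\<lambda>xs. (F ^^ (xs ! 0)) (xs ! 1))"
    unfolding numeral_2_eq_2
    by (rule computable_cong) (auto simp: length_Suc_conv rec)
qed

section \<open>A structured language for counter programs\<close>

text \<open>\<open>Loop r c\<close> decrements \<open>r\<close> before each execution of its body.\<close>

datatype com = Inc nat | Seq com com | Loop nat com

inductive big_step :: "com \<Rightarrow> (nat \<Rightarrow> nat) \<Rightarrow> (nat \<Rightarrow> nat) \<Rightarrow> bool" where
  big_Inc: "big_step (Inc r) s (s(r := Suc (s r)))"
| big_Seq: "big_step c s t \<Longrightarrow> big_step d t u \<Longrightarrow> big_step (Seq c d) s u"
| big_Loop_0: "s r = 0 \<Longrightarrow> big_step (Loop r c) s s"
| big_Loop_Suc: "s r = Suc n \<Longrightarrow> big_step c (s(r := n)) t \<Longrightarrow> big_step (Loop r c) t u \<Longrightarrow>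
    big_step (Loop r c) s u"

lemma big_step_eq: "big_step c s t \<Longrightarrow> t = t' \<Longrightarrow> big_step c s t'"
  by simp

text \<open>The language has no empty command. A loop over a register that holds zero acts as one,
  so \<open>z\<close> must be a register known to be zero.\<close>

definition skip :: "nat \<Rightarrow> com" where "skip z = Loop z (Inc z)"

lemma big_skip: "s z = 0 \<Longrightarrow> big_step (skip z) s s"
  unfolding skip_def by (rule big_Loop_0)

definition clear :: "nat \<Rightarrow> nat \<Rightarrow> com" where "clear z r = Loop r (skip z)"

lemma big_clear: "s z = 0 \<Longrightarrow> z \<noteq> r \<Longrightarrow> big_step (clear z r) s (s(r := 0))"
proof (induction "s r" arbitrary: s)
  case 0
  then show ?case unfolding clear_def by (metis big_Loop_0 fun_upd_triv)
next
  case (Suc n)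
  have "big_step (clear z r) (s(r := n)) ((s(r := n))(r := 0))" by (rule Suc.hyps(1)) (use Suc.prems in auto)
  moreover have "big_step (skip z) (s(r := n)) (s(r := n))"
    using Suc.prems by (intro big_skip) simp
  ultimately show ?case unfolding clear_def using Suc.hyps(2) by (metis big_Loop_Suc fun_upd_upd)
qed

definition move :: "nat \<Rightarrow> nat \<Rightarrow> com" where "move r r' = Loop r (Inc r')"

lemma big_move: "r \<noteq> r' \<Longrightarrow> big_step (move r r') s (s(r := 0, r' := s r' + s r))"
proof (induction "s r" arbitrary: s)
  case 0
  then show ?case unfolding move_def by (intro big_step_eq[OF big_Loop_0]) (auto simp: fun_eq_iff)
next
  case (Suc n)
  let ?s = "s(r := n, r' := Suc (s r'))"
  have "big_step (move r r') ?s (?s(r := 0, r' := ?s r' + ?s r))" by (rule Suc.hyps(1)) (use Suc.prems in auto)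
  moreover have "big_step (Inc r') (s(r := n)) ?s"
    using Suc.prems by (intro big_step_eq[OF big_Inc]) auto
  moreover have "?s(r := 0, r' := ?s r' + ?s r) = s(r := 0, r' := s r' + s r)"
    using Suc.prems Suc.hyps(2) by (auto simp: fun_eq_iff)
  ultimately show ?case unfolding move_def using Suc.hyps(2) by (metis big_Loop_Suc)
qed

text \<open>Reading a register destroys it, so \<open>r\<close> is drained into both
  \<open>r'\<close> and the auxiliary \<open>z\<close> and then restored from
  \<open>z\<close>.\<close>

definition copy :: "nat \<Rightarrow> nat \<Rightarrow> nat \<Rightarrow> com" where
  "copy z r r' = Seq (Loop r (Seq (Inc r') (Inc z))) (move z r)"

lemma big_copy:
  assumes "s r' = 0" "s z = 0" and ne: "r \<noteq> r'" "r \<noteq> z" "r' \<noteq> z"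
  shows "big_step (copy z r r') s (s(r' := s r))"
proof -
  have "big_step (Loop r (Seq (Inc r') (Inc z))) s (s(r := 0, r' := s r' + s r, z := s z + s r))" for s
  proof (induction "s r" arbitrary: s)
    case 0
    then show ?case using ne by (intro big_step_eq[OF big_Loop_0]) (auto simp: fun_eq_iff)
  next
    case (Suc n)
    let ?s = "s(r := n, r' := Suc (s r'), z := Suc (s z))"
    have "big_step (Seq (Inc r') (Inc z)) (s(r := n)) ?s"
      using ne by (intro big_Seq[OF big_Inc] big_step_eq[OF big_Inc]) auto
    moreover have "big_step (Loop r (Seq (Inc r') (Inc z))) ?s (?s(r := 0, r' := ?s r' + ?s r, z := ?s z + ?s r))"
      by (rule Suc.hyps(1)) (use ne in auto)
    moreover have "?s(r := 0, r' := ?s r' + ?s r, z := ?s z + ?s r) = s(r := 0, r' := s r' + s r, z := s z + s r)"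
      using ne Suc.hyps(2) by (auto simp: fun_eq_iff)
    ultimately show ?case using Suc.hyps(2) by (metis big_Loop_Suc)
  qed
  note this[of s]
  moreover have "big_step (move z r) (s(r := 0, r' := s r' + s r, z := s z + s r)) (s(r' := s r))"
    by (rule big_step_eq[OF big_move]) (use assms in \<open>auto simp: fun_eq_iff\<close>)
  ultimately show ?thesis unfolding copy_def by (rule big_Seq)
qed

section \<open>Compiling recursive functions into the language\<close>

text \<open>Calling convention: arguments in the registers \<open>rs\<close>, result in register \<open>k\<close>, all registers
  from \<open>k\<close> on are zero at the start and serve as scratch space that is cleared again.\<close>

definition implements :: "com \<Rightarrow> recf \<Rightarrow> nat list \<Rightarrow> nat \<Rightarrow> bool" where
  "implements c f rs k \<longleftrightarrow> (\<forall>s y. (\<forall>j \<ge> k. s j = 0) \<longrightarrow> rec_eval f (map s rs) y \<longrightarrow>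
     big_step c s (s(k := y)))"

lemma implementsD:
  "implements c f rs k \<Longrightarrow> (\<And>j. j \<ge> k \<Longrightarrow> s j = 0) \<Longrightarrow> map s rs = xs \<Longrightarrow> rec_eval f xs y \<Longrightarrow>
    s(k := y) = t \<Longrightarrow> big_step c s t"
  unfolding implements_def by blast

text \<open>The values of \<open>gs\<close> land in consecutive registers from \<open>k\<close> on.
  Each call shifts the scratch area by one, so \<open>k\<close> varies in the induction; the
  arguments lie below \<open>k\<close> and stay intact.\<close>

lemma implements_list:
  assumes "\<And>g k. g \<in> set gs \<Longrightarrow> \<forall>r \<in> set rs. r < k \<Longrightarrow> \<exists>c. implements c g rs k"
    and "\<forall>r \<in> set rs. r < k"
  shows "\<exists>c. \<forall>s ys. (\<forall>j \<ge> k. s j = 0) \<longrightarrow> list_all2 (\<lambda>g y. rec_eval g (map s rs) y) gs ys \<longrightarrow>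
    big_step c s (\<lambda>j. if k \<le> j \<and> j < k + length gs then ys ! (j - k) else s j)"
  using assms
proof (induction gs arbitrary: k)
  case Nil
  show ?case by (rule exI[of _ "skip k"]) (auto intro!: big_step_eq[OF big_skip])
next
  case (Cons g gs)
  obtain c where c: "implements c g rs k" using Cons.prems by (metis list.set_intros(1))
  have rs: "\<forall>r \<in> set rs. r < Suc k" using Cons.prems(2) by (simp add: less_Suc_eq)
  obtain d where d: "\<And>s ys. \<forall>j \<ge> Suc k. s j = 0 \<Longrightarrow> list_all2 (\<lambda>g y. rec_eval g (map s rs) y) gs ys \<Longrightarrow>
    big_step d s (\<lambda>j. if Suc k \<le> j \<and> j < Suc k + length gs then ys ! (j - Suc k) else s j)"
    using Cons.IH[OF Cons.prems(1), of "Suc k"] rs by (simp del: fun_upd_apply) blast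
  show ?case
  proof (intro exI[of _ "Seq c d"] allI impI)
    fix s :: "nat \<Rightarrow> nat" and ys
    assume z: "\<forall>j \<ge> k. s j = 0" and l: "list_all2 (\<lambda>g y. rec_eval g (map s rs) y) (g # gs) ys"
    then obtain y ys' where ys: "ys = y # ys'" "rec_eval g (map s rs) y"
      "list_all2 (\<lambda>g y. rec_eval g (map s rs) y) gs ys'" by (auto simp: list_all2_Cons1)
    have m: "map (s(k := y)) rs = map s rs" using Cons.prems(2) by (auto simp: less_le)
    have "big_step d (s(k := y)) (\<lambda>j. if Suc k \<le> j \<and> j < Suc k + length gs then ys' ! (j - Suc k) else (s(k := y)) j)"
    proof (rule d)
      show "list_all2 (\<lambda>g. rec_eval g (map (s(k := y)) rs)) gs ys'" unfolding m by (rule ys(3))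
    qed (use z in simp)
    moreover have "big_step c s (s(k := y))" by (rule implementsD[OF c]) (use z ys in auto)
    ultimately have bs: "big_step (Seq c d) s (\<lambda>j. if Suc k \<le> j \<and> j < Suc k + length gs then ys' ! (j - Suc k) else (s(k := y)) j)"
      by (intro big_Seq)
    have eq: "(\<lambda>j. if Suc k \<le> j \<and> j < Suc k + length gs then ys' ! (j - Suc k) else (s(k := y)) j)
      = (\<lambda>j. if k \<le> j \<and> j < k + length (g # gs) then ys ! (j - k) else s j)"
      by (auto simp: fun_eq_iff ys nth_Cons Suc_le_eq diff_Suc split: nat.split)
    from bs show "big_step (Seq c d) s (\<lambda>j. if k \<le> j \<and> j < k + length (g # gs) then ys ! (j - k) else s j)"
      unfolding eq .
  qed
qed

lemma clear_range:
  "\<exists>c. \<forall>s. s (k + m) = 0 \<longrightarrow> big_step c s (\<lambda>j. if k \<le> j \<and> j < k + m then 0 else s j)"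
proof -
  \<comment> \<open>The zero register needed by \<open>clear\<close> stays fixed while
    \<open>m\<close> varies in the induction, so it is detached from \<open>k + m\<close>.\<close>
  have "\<exists>c. \<forall>s. s z = 0 \<longrightarrow> big_step c s (\<lambda>j. if k \<le> j \<and> j < k + m then 0 else s j)" if "z \<ge> k + m" for z
    using that
  proof (induction m)
    case 0
    show ?case by (rule exI[of _ "skip z"]) (auto intro!: big_step_eq[OF big_skip])
  next
    case (Suc m)
    then obtain c where c: "\<And>s. s z = 0 \<Longrightarrow> big_step c s (\<lambda>j. if k \<le> j \<and> j < k + m then 0 else s j)" by auto
    have "big_step (Seq c (clear z (k + m))) s (\<lambda>j. if k \<le> j \<and> j < k + Suc m then 0 else s j)" if "s z = 0" for s
      by (rule big_Seq[OF c], rule that, rule big_step_eq[OF big_clear])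
        (use Suc.prems that in \<open>auto simp: fun_eq_iff\<close>)
    then show ?case by blast
  qed
  then show ?thesis by blast
qed

text \<open>Register layout: the values of \<open>gs\<close> fill the registers after
  \<open>k\<close>, and \<open>f\<close> writes its value to the next one, \<open>?e\<close>. This
  value is moved to \<open>k\<close> and the intermediate values are erased; after the move
  \<open>?e\<close> is zero again, as \<open>clear_range\<close> requires.\<close>

lemma implements_Comp:
  assumes f: "\<And>rs k. \<forall>r \<in> set rs. r < k \<Longrightarrow> \<exists>c. implements c f rs k"
    and gs: "\<And>g rs k. g \<in> set gs \<Longrightarrow> \<forall>r \<in> set rs. r < k \<Longrightarrow> \<exists>c. implements c g rs k"
    and rs: "\<forall>r \<in> set rs. r < k"
  shows "\<exists>c. implements c (Comp f gs) rs k"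
proof -
  let ?m = "length gs"
  let ?e = "Suc k + ?m"
  obtain c where c: "\<And>s ys. \<forall>j \<ge> Suc k. s j = 0 \<Longrightarrow> list_all2 (\<lambda>g y. rec_eval g (map s rs) y) gs ys \<Longrightarrow>
    big_step c s (\<lambda>j. if Suc k \<le> j \<and> j < ?e then ys ! (j - Suc k) else s j)"
    using implements_list[of gs rs "Suc k", OF gs] rs by (simp add: less_Suc_eq) blast
  obtain d where d: "implements d f [Suc k..<?e] ?e" using f[of "[Suc k..<?e]" ?e] by (auto simp del: upt_Suc)
  obtain e where e: "\<And>s. s ?e = 0 \<Longrightarrow> big_step e s (\<lambda>j. if Suc k \<le> j \<and> j < ?e then 0 else s j)"
    using clear_range[of "Suc k" ?m] by blast
  have "implements (Seq c (Seq d (Seq (move ?e k) e))) (Comp f gs) rs k"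
    unfolding implements_def
  proof (intro allI impI)
    fix s z assume z: "\<forall>j \<ge> k. s j = 0" and "rec_eval (Comp f gs) (map s rs) z"
    then obtain ys where ys: "list_all2 (\<lambda>g y. rec_eval g (map s rs) y) gs ys" "rec_eval f ys z"
      by (auto elim: rec_eval_CompE)
    have len: "length ys = ?m" using ys(1) list_all2_lengthD by metis
    let ?s1 = "\<lambda>j. if Suc k \<le> j \<and> j < ?e then ys ! (j - Suc k) else s j"
    have "map ?s1 [Suc k..<?e] = ys" by (rule nth_equalityI) (auto simp: len simp del: upt_Suc)
    then have "big_step d ?s1 (?s1(?e := z))" using z ys by (intro implementsD[OF d]) auto
    moreover have "big_step c s ?s1" using z ys by (intro c) auto
    moreover have "big_step (move ?e k) (?s1(?e := z)) (?s1(k := z))"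
      by (rule big_step_eq[OF big_move]) (use z in \<open>auto simp: fun_eq_iff\<close>)
    moreover have "big_step e (?s1(k := z)) (s(k := z))"
      by (rule big_step_eq[OF e]) (use z in \<open>auto simp: fun_eq_iff\<close>)
    ultimately show "big_step (Seq c (Seq d (Seq (move ?e k) e))) s (s(k := z))"
      by (intro big_Seq)
  qed
  then show ?thesis by blast
qed

text \<open>A recursion value at \<open>n\<close> presupposes values at all smaller arguments. They
  are the intermediate results of the compiled loop.\<close>

lemma rec_eval_PrimRec_prefix:
  "rec_eval (PrimRec f g) (n # xs) r \<Longrightarrow> i \<le> n \<Longrightarrow> \<exists>r. rec_eval (PrimRec f g) (i # xs) r"
proof (induction n arbitrary: r)
  case (Suc n)
  then show ?case by (cases "i = Suc n") (auto elim: rec_eval_PrimRec_SucE)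
qed auto

text \<open>Register layout: \<open>k\<close> holds the value at stage \<open>i\<close>,
  \<open>Suc k\<close> the index \<open>i\<close>, \<open>k + 2\<close> the number of remaining
  rounds, and \<open>k + 3\<close> receives the results of \<open>f\<close> and \<open>g\<close>,
  with scratch space above it.\<close>

lemma implements_PrimRec:
  assumes f: "\<And>rs k. \<forall>r \<in> set rs. r < k \<Longrightarrow> \<exists>c. implements c f rs k"
    and g: "\<And>rs k. \<forall>r \<in> set rs. r < k \<Longrightarrow> \<exists>c. implements c g rs k"
    and rs: "\<forall>r \<in> set rs. r < k"
  shows "\<exists>c. implements c (PrimRec f g) rs k"
proof (cases rs)
  case Nil
  \<comment> \<open>Primitive recursion has no value on the empty argument list, so this case is
    vacuous.\<close>
  then show ?thesis by (auto simp: implements_def elim: rec_eval.cases)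
next
  case (Cons a as)
  have as: "r < k" if "r \<in> set as" for r using rs Cons that by auto
  have a: "a < k" using rs Cons by auto
  obtain c where c: "implements c f as (k + 3)" using f as by (metis trans_less_add1)
  obtain d where d: "implements d g (Suc k # k # as) (k + 3)"
    using g[of "Suc k # k # as" "k + 3"] as by (auto simp: trans_less_add1)
  let ?b = "Seq d (Seq (clear (k + 4) k) (Seq (move (k + 3) k) (Inc (Suc k))))"
  let ?p = "Seq (copy (k + 3) a (k + 2)) (Seq c (Seq (move (k + 3) k)
      (Seq (Loop (k + 2) ?b) (clear (k + 2) (Suc k)))))"
  have "implements ?p (PrimRec f g) rs k"
    unfolding implements_def
  proof (intro allI impI)
    fix s y assume z: "\<forall>j \<ge> k. s j = 0" and ev: "rec_eval (PrimRec f g) (map s rs) y"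
    let ?xs = "map s as"
    let ?st = "\<lambda>r i m. s(k := r, Suc k := i, k + 2 := m)"
    have ev: "rec_eval (PrimRec f g) (s a # ?xs) y" using ev Cons by simp
    have xs: "map (?st r i m) as = ?xs" for r i m using as by fastforce
    \<comment> \<open>Invariant: \<open>k\<close> holds the recursion value at \<open>i\<close>, and
      \<open>m\<close> rounds are left to reach \<open>s a\<close>.\<close>
    have loop: "big_step (Loop (k + 2) ?b) (?st r i m) (?st y (i + m) 0)"
      if "rec_eval (PrimRec f g) (i # ?xs) r" "i + m = s a" for i m r
      using that
    proof (induction m arbitrary: i r)
      case 0
      then have "r = y" using ev rec_eval_deterministic by simp
      then show ?case by (intro big_step_eq[OF big_Loop_0]) auto
    next
      case (Suc m)
      have "\<exists>r. rec_eval (PrimRec f g) (Suc i # ?xs) r"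
        by (rule rec_eval_PrimRec_prefix[OF ev]) (use Suc.prems in auto)
      then obtain r' where r': "rec_eval (PrimRec f g) (Suc i # ?xs) r'" by blast
      \<comment> \<open>The derivation at \<open>Suc i\<close> uses some value at \<open>i\<close>;
        determinism identifies it with \<open>r\<close>.\<close>
      then have g': "rec_eval g (i # r # ?xs) r'"
        using Suc.prems(1) by (metis rec_eval_PrimRec_SucE rec_eval_deterministic)
      let ?t = "?st r i m"
      have "map ?t (Suc k # k # as) = i # r # ?xs" using xs[of r i m] by simp
      then have "big_step d ?t (?t(k + 3 := r'))"
        by (rule implementsD[OF d _ _ g' refl, rotated]) (use z in auto)
      moreover have "big_step (clear (k + 4) k) (?t(k + 3 := r')) (?t(k + 3 := r', k := 0))"
        by (rule big_clear) (use z in auto)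
      moreover have "big_step (move (k + 3) k) (?t(k + 3 := r', k := 0)) (?st r' i m)"
        by (rule big_step_eq[OF big_move]) (use z in \<open>auto simp: fun_eq_iff\<close>)
      moreover have "big_step (Inc (Suc k)) (?st r' i m) (?st r' (Suc i) m)"
        by (rule big_step_eq[OF big_Inc]) (auto simp: fun_eq_iff)
      ultimately have body: "big_step ?b ?t (?st r' (Suc i) m)" by (intro big_Seq)
      have "big_step (Loop (k + 2) ?b) (?st r' (Suc i) m) (?st y (Suc i + m) 0)"
        by (rule Suc.IH[OF r']) (use Suc.prems in auto)
      then have rest: "big_step (Loop (k + 2) ?b) (?st r' (Suc i) m) (?st y (i + Suc m) 0)"
        by (simp only: add_Suc_shift)
      have "(?st r i (Suc m))(k + 2 := m) = ?t" by (rule fun_upd_upd)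
      with body have "big_step ?b ((?st r i (Suc m))(k + 2 := m)) (?st r' (Suc i) m)"
        by (simp only:)
      from big_Loop_Suc[OF _ this rest] show ?case by (simp only: fun_upd_same)
    qed
    obtain r0 where r0: "rec_eval (PrimRec f g) (0 # ?xs) r0"
      using rec_eval_PrimRec_prefix[OF ev, of 0] by auto
    then have f0: "rec_eval f ?xs r0" by (auto elim: rec_eval_PrimRec_0E)
    have "big_step (copy (k + 3) a (k + 2)) s (s(k + 2 := s a))"
      by (rule big_copy) (use z a in auto)
    moreover have "map (s(k + 2 := s a)) as = ?xs" using as by fastforce
    then have "big_step c (s(k + 2 := s a)) (s(k + 2 := s a, k + 3 := r0))"
      by (rule implementsD[OF c _ _ f0 refl, rotated]) (use z in auto)
    moreover have "big_step (move (k + 3) k) (s(k + 2 := s a, k + 3 := r0)) (?st r0 0 (s a))"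
      by (rule big_step_eq[OF big_move]) (use z in \<open>auto simp: fun_eq_iff\<close>)
    moreover have "big_step (Loop (k + 2) ?b) (?st r0 0 (s a)) (?st y (0 + s a) 0)"
      by (rule loop[OF r0]) auto
    moreover have "big_step (clear (k + 2) (Suc k)) (?st y (0 + s a) 0) (s(k := y))"
      by (rule big_step_eq[OF big_clear]) (use z in \<open>auto simp: fun_eq_iff\<close>)
    ultimately show "big_step ?p s (s(k := y))" by (intro big_Seq)
  qed
  then show ?thesis by blast
qed

text \<open>\<open>k\<close> holds the current candidate and \<open>Suc k\<close> the value of
  \<open>f\<close> there. The loop runs while this value is nonzero, and stops at the least zero
  with \<open>Suc k\<close> already clean.\<close>

lemma implements_Mu:
  assumes f: "\<And>rs k. \<forall>r \<in> set rs. r < k \<Longrightarrow> \<exists>c. implements c f rs k"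
    and rs: "\<forall>r \<in> set rs. r < k"
  shows "\<exists>c. implements c (Mu f) rs k"
proof -
  have "\<forall>r \<in> set (k # rs). r < Suc k" using rs by (simp add: less_Suc_eq)
  from f[OF this] obtain c where c: "implements c f (k # rs) (Suc k)" ..
  let ?b = "Seq (clear (k + 2) (Suc k)) (Seq (Inc k) c)"
  have "implements (Seq c (Loop (Suc k) ?b)) (Mu f) rs k"
    unfolding implements_def
  proof (intro allI impI)
    fix s n assume z: "\<forall>j \<ge> k. s j = 0" and ev: "rec_eval (Mu f) (map s rs) n"
    let ?xs = "map s rs"
    have ev: "rec_eval f (n # ?xs) 0" "\<forall>m < n. \<exists>k. rec_eval f (m # ?xs) (Suc k)"
      using ev by (auto elim: rec_eval_MuE)
    have step: "big_step c (s(k := i)) (s(k := i, Suc k := r))" if "rec_eval f (i # ?xs) r" for i r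
    proof -
      have "map (s(k := i)) (k # rs) = i # ?xs" using rs by fastforce
      then show ?thesis by (rule implementsD[OF c _ _ that refl, rotated]) (use z in auto)
    qed
    have loop: "big_step (Loop (Suc k) ?b) (s(k := i, Suc k := r)) (s(k := n))"
      if "rec_eval f (i # ?xs) r" "i + m = n" for i m r
      using that
    proof (induction m arbitrary: i r)
      case 0
      then have "r = 0" using ev rec_eval_deterministic by auto
      then show ?case using 0 z by (intro big_step_eq[OF big_Loop_0]) (auto simp: fun_eq_iff)
    next
      case (Suc m)
      obtain l where "rec_eval f (i # ?xs) (Suc l)" using ev(2) Suc.prems(2) by fastforce
      then have r: "r = Suc l" using Suc.prems(1) rec_eval_deterministic by blast
      have "Suc i = n \<or> Suc i < n" using Suc.prems(2) by auto
      then obtain r' where r': "rec_eval f (Suc i # ?xs) r'" using ev by blast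
      have c1: "big_step (clear (k + 2) (Suc k)) (s(k := i, Suc k := l)) (s(k := i))"
        by (rule big_step_eq[OF big_clear]) (use z in \<open>auto simp: fun_eq_iff\<close>)
      have c2: "big_step (Inc k) (s(k := i)) (s(k := Suc i))"
        by (rule big_step_eq[OF big_Inc]) (auto simp: fun_eq_iff)
      from big_Seq[OF c1 big_Seq[OF c2 step[OF r']]]
      have body: "big_step ?b ((s(k := i, Suc k := r))(Suc k := l)) (s(k := Suc i, Suc k := r'))"
        by (simp only: fun_upd_upd)
      have "big_step (Loop (Suc k) ?b) (s(k := Suc i, Suc k := r')) (s(k := n))"
        by (rule Suc.IH[OF r']) (use Suc.prems in auto)
      from big_Loop_Suc[OF _ body this] show ?case using r by (simp only: fun_upd_same)
    qed
    obtain r where r: "rec_eval f (0 # ?xs) r" using ev by (metis gr0I)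
    have "big_step c s (s(k := 0, Suc k := r))" using step[OF r] z by (simp add: fun_upd_idem)
    with loop[OF r, of n] show "big_step (Seq c (Loop (Suc k) ?b)) s (s(k := n))"
      by (auto intro: big_Seq)
  qed
  then show ?thesis by blast
qed

text \<open>\<open>implements\<close> constrains a program only where the function has a value, so
  argument lists on which \<open>Sc\<close> or \<open>Proj\<close> is undefined give vacuous
  cases.\<close>

lemma ex_implements: "\<forall>r \<in> set rs. r < k \<Longrightarrow> \<exists>c. implements c f rs k"
proof (induction f arbitrary: rs k)
  case Zr
  have "big_step (skip k) s (s(k := 0))" if "\<forall>j \<ge> k. s j = 0" for s
    by (rule big_step_eq[OF big_skip]) (use that in auto)
  then show ?case unfolding implements_def by (blast elim: rec_eval_ZrE)
next
  case Sc
  show ?case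
  proof (cases "length rs = 1")
    case True
    then obtain r where r: "rs = [r]" by (auto simp: length_Suc_conv)
    have "big_step (Seq (copy (Suc k) r k) (Inc k)) s (s(k := Suc (s r)))" if "\<forall>j \<ge> k. s j = 0" for s
      by (rule big_Seq[OF big_copy], use that Sc r in auto, rule big_step_eq[OF big_Inc], auto)
    then have "implements (Seq (copy (Suc k) r k) (Inc k)) Sc rs k"
      unfolding implements_def by (auto simp: r elim!: rec_eval_ScE)
    then show ?thesis by blast
  next
    case False
    then show ?thesis by (auto simp: implements_def elim!: rec_eval_ScE dest: arg_cong[of _ _ length])
  qed
next
  case (Proj i)
  show ?case
  proof (cases "i < length rs")
    case True
    have "big_step (copy (Suc k) (rs ! i) k) s (s(k := s (rs ! i)))" if "\<forall>j \<ge> k. s j = 0" for s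
      by (rule big_copy) (use that Proj True nth_mem in \<open>fastforce\<close>)+
    then have "implements (copy (Suc k) (rs ! i) k) (Proj i) rs k"
      unfolding implements_def by (auto simp: True elim!: rec_eval_ProjE)
    then show ?thesis by blast
  next
    case False
    then show ?thesis by (auto simp: implements_def elim!: rec_eval_ProjE)
  qed
next
  case (Comp f gs)
  show ?case by (rule implements_Comp) (use Comp in auto)
next
  case (PrimRec f g)
  show ?case by (rule implements_PrimRec) (use PrimRec in auto)
next
  case (Mu f)
  show ?case by (rule implements_Mu) (use Mu in auto)
qed

section \<open>Counter machines and the translation of programs into them\<close>

text \<open>\<open>DJZ r q q'\<close> decrements \<open>r\<close> and continues at \<open>q\<close>, or continues at \<open>q'\<close> if \<open>r\<close> is zero;
  every address outside the program is halting.\<close>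

datatype instr = INC nat nat | DJZ nat nat nat

inductive halts :: "instr list \<Rightarrow> nat \<Rightarrow> (nat \<Rightarrow> nat) \<Rightarrow> bool" for P where
  halts_end: "length P \<le> q \<Longrightarrow> halts P q s"
| halts_INC: "q < length P \<Longrightarrow> P ! q = INC r q' \<Longrightarrow> halts P q' (s(r := Suc (s r))) \<Longrightarrow> halts P q s"
| halts_dec: "q < length P \<Longrightarrow> P ! q = DJZ r q' q'' \<Longrightarrow> s r = Suc n \<Longrightarrow> halts P q' (s(r := n)) \<Longrightarrow> halts P q s"
| halts_zero: "q < length P \<Longrightarrow> P ! q = DJZ r q' q'' \<Longrightarrow> s r = 0 \<Longrightarrow> halts P q'' s \<Longrightarrow> halts P q s"

lemma halts_INC_iff:
  "q < length P \<Longrightarrow> P ! q = INC r q' \<Longrightarrow> halts P q s \<longleftrightarrow> halts P q' (s(r := Suc (s r)))"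
  by (auto elim: halts.cases intro: halts_INC)

lemma halts_dec_iff:
  "q < length P \<Longrightarrow> P ! q = DJZ r q' q'' \<Longrightarrow> s r = Suc n \<Longrightarrow> halts P q s \<longleftrightarrow> halts P q' (s(r := n))"
  by (auto elim: halts.cases intro: halts_dec)

lemma halts_zero_iff:
  "q < length P \<Longrightarrow> P ! q = DJZ r q' q'' \<Longrightarrow> s r = 0 \<Longrightarrow> halts P q s \<longleftrightarrow> halts P q'' s"
  by (auto elim: halts.cases intro: halts_zero)

text \<open>The source of deliberate divergence in \<open>ex_halting_program\<close>: a finite
  halting derivation would have to repeat the same instruction without ever leaving it.\<close>

lemma not_halts_self_loop:
  assumes "q < length P" "P ! q = INC r q"
  shows "\<not> halts P q s"
proof
  assume "halts P q s"
  then show False using assms by (induction q s rule: halts.induct) auto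
qed

fun com_size :: "com \<Rightarrow> nat" where
  "com_size (Inc r) = 1"
| "com_size (Seq c d) = com_size c + com_size d"
| "com_size (Loop r c) = Suc (com_size c)"

text \<open>\<open>a\<close> is the address of the first instruction and \<open>e\<close> the exit
  address. A loop body is compiled with exit \<open>a\<close>, which returns control to the
  test.\<close>

fun compile :: "com \<Rightarrow> nat \<Rightarrow> nat \<Rightarrow> instr list" where
  "compile (Inc r) a e = [INC r e]"
| "compile (Seq c d) a e = compile c a (a + com_size c) @ compile d (a + com_size c) e"
| "compile (Loop r c) a e = DJZ r (Suc a) e # compile c (Suc a) a"

lemma length_compile [simp]: "length (compile c a e) = com_size c"
  by (induction c arbitrary: a e) auto

text \<open>The equivalence, rather than an implication, is available because machines are deterministic;
  it makes a converse simulation unnecessary.\<close>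

lemma halts_compile:
  assumes "big_step c s t" "P = pre @ compile c (length pre) e @ post"
  shows "halts P (length pre) s \<longleftrightarrow> halts P e t"
  using assms
proof (induction arbitrary: pre post e rule: big_step.induct)
  case (big_Inc r s)
  then show ?case by (intro halts_INC_iff) auto
next
  case (big_Seq c s t d u)
  have "halts P (length pre) s \<longleftrightarrow> halts P (length pre + com_size c) t"
    by (rule big_Seq.IH(1)) (use big_Seq.prems in simp)
  also have "\<dots> \<longleftrightarrow> halts P e u"
    using big_Seq.IH(2)[of "pre @ compile c (length pre) (length pre + com_size c)"] big_Seq.prems by simp
  finally show ?case .
next
  case (big_Loop_0 s r c)
  then show ?case by (intro halts_zero_iff) auto
next
  case (big_Loop_Suc s r n c t u)
  have "halts P (length pre) s \<longleftrightarrow> halts P (Suc (length pre)) (s(r := n))"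
    using big_Loop_Suc.hyps big_Loop_Suc.prems by (intro halts_dec_iff) auto
  also have "\<dots> \<longleftrightarrow> halts P (length pre) t"
    using big_Loop_Suc.IH(1)[of "pre @ [DJZ r (Suc (length pre)) e]" "length pre"] big_Loop_Suc.prems
    by (simp del: fun_upd_apply)
  also have "\<dots> \<longleftrightarrow> halts P e u" by (rule big_Loop_Suc.IH(2)[OF big_Loop_Suc.prems])
  finally show ?case .
qed

lemma ex_halting_program:
  "\<exists>P. \<forall>s y. (\<forall>j \<ge> k. s j = 0) \<longrightarrow> rec_eval f (map s [0..<k]) y \<longrightarrow>
     (halts P 0 s \<longleftrightarrow> y = 0)"
proof -
  obtain c where c: "implements c f [0..<k] (k)"
    using ex_implements[of "[0..<k]" k f] by auto
  let ?n = "com_size c"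
  \<comment> \<open>The result in register \<open>k\<close> is tested: zero leads to
    \<open>?n + 2\<close>, the first address outside the program, and anything else to the self-loop
    at \<open>Suc ?n\<close>.\<close>
  let ?P = "compile c 0 ?n @ [DJZ k (Suc ?n) (?n + 2), INC 0 (Suc ?n)]"
  have "halts ?P 0 s \<longleftrightarrow> y = 0"
    if s: "\<forall>j \<ge> k. s j = 0" "rec_eval f (map s [0..<k]) y" for s y
  proof -
    have "big_step c s (s(k := y))" by (rule implementsD[OF c]) (use s in auto)
    then have "halts ?P 0 s \<longleftrightarrow> halts ?P ?n (s(k := y))"
      using halts_compile[where pre = "[]"] by simp
    also have "\<dots> \<longleftrightarrow> y = 0"
    proof (cases y)
      case 0
      then show ?thesis using halts_zero_iff[of ?n ?P] halts_end by (simp add: nth_append)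
    next
      case (Suc n)
      then show ?thesis
        using halts_dec_iff[of ?n ?P] not_halts_self_loop[of "Suc ?n" ?P] by (simp add: nth_append)
    qed
    finally show ?thesis .
  qed
  then show ?thesis by blast
qed

section \<open>Programs as labelled graphs\<close>

datatype counter_op = Nop | Incr nat | Decr nat | Zero nat

fun exec :: "counter_op \<Rightarrow> (nat \<Rightarrow> nat) \<Rightarrow> (nat \<Rightarrow> nat) \<Rightarrow> bool" where
  "exec Nop s t \<longleftrightarrow> t = s"
| "exec (Incr r) s t \<longleftrightarrow> t = s(r := Suc (s r))"
| "exec (Decr r) s t \<longleftrightarrow> (\<exists>n. s r = Suc n \<and> t = s(r := n))"
| "exec (Zero r) s t \<longleftrightarrow> s r = 0 \<and> t = s"

fun run :: "counter_op list \<Rightarrow> (nat \<Rightarrow> nat) \<Rightarrow> (nat \<Rightarrow> nat) \<Rightarrow> bool" where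
  "run [] s t \<longleftrightarrow> t = s"
| "run (c # cs) s u \<longleftrightarrow> (\<exists>t. exec c s t \<and> run cs t u)"

lemma run_append: "run (cs @ ds) s u \<longleftrightarrow> (\<exists>t. run cs s t \<and> run ds t u)"
  by (induction cs arbitrary: s) auto

lemma run_replicate_Incr: "run (replicate n (Incr r)) s t \<longleftrightarrow> t = s(r := s r + n)"
proof (induction n arbitrary: s)
  case (Suc n)
  then show ?case by (simp del: fun_upd_apply) (simp add: fun_upd_def)
qed simp

text \<open>Letters: 0 is reserved for Environment, 1 starts the word, 2 and 3 increment the input registers,
  4 ends the input, 5 is halting, and \<open>6 + 2 * q\<close>, \<open>7 + 2 * q\<close> are the transitions of instruction \<open>q\<close>
  (the second one only for the zero branch of a \<open>DJZ\<close>).\<close>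

definition pc_letters :: "instr list \<Rightarrow> nat \<Rightarrow> nat set" where
  "pc_letters P q = (if q < length P
     then (case P ! q of INC r q' \<Rightarrow> {6 + 2 * q} | DJZ r q' q'' \<Rightarrow> {6 + 2 * q, 7 + 2 * q})
     else {5})"

text \<open>The default 0 makes letter 4 enter the program at its first instruction.\<close>

definition target :: "instr list \<Rightarrow> nat \<Rightarrow> nat" where
  "target P l = (if l < 6 then 0
     else (case P ! ((l - 6) div 2) of INC r q' \<Rightarrow> q' | DJZ r q' q'' \<Rightarrow> if even l then q' else q''))"

definition letter_op :: "instr list \<Rightarrow> nat \<Rightarrow> counter_op" where
  "letter_op P l = (if l = 2 then Incr 0 else if l = 3 then Incr 1 else if l < 6 then Nop
     else (case P ! ((l - 6) div 2) of INC r q' \<Rightarrow> Incr r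
       | DJZ r q' q'' \<Rightarrow> if even l then Decr r else Zero r))"

text \<open>Input letters may occur here in any order and number; the actual input is imposed by
  \<open>input_formula\<close>. Letter 5 has no successor, so a path ends when the machine
  halts.\<close>

definition edge :: "instr list \<Rightarrow> nat \<Rightarrow> nat \<Rightarrow> bool" where
  "edge P l m \<longleftrightarrow> (if l \<in> {1, 2, 3} then m \<in> {2, 3, 4}
     else if l = 4 \<or> 6 \<le> l then m \<in> pc_letters P (target P l) else False)"

lemma edge_input: "l \<in> {1, 2, 3} \<Longrightarrow> edge P l m \<longleftrightarrow> m \<in> {2, 3, 4}"
  by (auto simp: edge_def)

lemma edge_pc: "l = 4 \<or> 6 \<le> l \<Longrightarrow> edge P l m \<longleftrightarrow> m \<in> pc_letters P (target P l)"
  by (auto simp: edge_def)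

lemma pc_letter_simps:
  "letter_op P (6 + 2 * q) = (case P ! q of INC r q' \<Rightarrow> Incr r | DJZ r q' q'' \<Rightarrow> Decr r)"
  "letter_op P (7 + 2 * q) = (case P ! q of INC r q' \<Rightarrow> Incr r | DJZ r q' q'' \<Rightarrow> Zero r)"
  "target P (6 + 2 * q) = (case P ! q of INC r q' \<Rightarrow> q' | DJZ r q' q'' \<Rightarrow> q')"
  "target P (7 + 2 * q) = (case P ! q of INC r q' \<Rightarrow> q' | DJZ r q' q'' \<Rightarrow> q'')"
  by (simp_all add: letter_op_def target_def split: instr.split)

text \<open>\<open>pc_letters\<close> yields legal letters for every address, even if
  \<open>l\<close> encodes no instruction of \<open>P\<close>, so the bound holds without any
  condition on \<open>l\<close>.\<close>

lemma edge_letter: "edge P l m \<Longrightarrow> 1 < m \<and> m < 6 + 2 * length P"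
  by (auto simp: edge_def pc_letters_def split: if_splits instr.splits)

lemma halts_imp_path:
  "halts P q s \<Longrightarrow> \<exists>ls t. successively (edge P) ls \<and> ls \<noteq> [] \<and> hd ls \<in> pc_letters P q \<and>
     run (map (letter_op P) ls) s t \<and> 5 \<in> set ls"
proof (induction rule: halts.induct)
  case (halts_end q s)
  then show ?case by (intro exI[of _ "[5]"]) (auto simp: pc_letters_def letter_op_def)
next
  case (halts_INC q r q' s)
  then obtain ls t where "successively (edge P) ls" "ls \<noteq> []" "hd ls \<in> pc_letters P q'"
    "run (map (letter_op P) ls) (s(r := Suc (s r))) t" "5 \<in> set ls" by blast
  with halts_INC.hyps show ?case
    by (intro exI[of _ "(6 + 2 * q) # ls"])
      (auto simp: pc_letters_def[of P q] pc_letter_simps edge_pc successively_Cons)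
next
  case (halts_dec q r q' q'' s n)
  then obtain ls t where "successively (edge P) ls" "ls \<noteq> []" "hd ls \<in> pc_letters P q'"
    "run (map (letter_op P) ls) (s(r := n)) t" "5 \<in> set ls" by blast
  with halts_dec.hyps show ?case
    by (intro exI[of _ "(6 + 2 * q) # ls"])
      (auto simp: pc_letters_def[of P q] pc_letter_simps edge_pc successively_Cons)
next
  case (halts_zero q r q' q'' s)
  then obtain ls t where "successively (edge P) ls" "ls \<noteq> []" "hd ls \<in> pc_letters P q''"
    "run (map (letter_op P) ls) s t" "5 \<in> set ls" by blast
  with halts_zero.hyps show ?case
    by (intro exI[of _ "(7 + 2 * q) # ls"])
      (auto simp: pc_letters_def[of P q] pc_letter_simps edge_pc successively_Cons)
qed

text \<open>Inside the program the first letter is not 5, so a nonempty rest of the path still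
  contains 5 and the induction continues; outside, the machine has already halted.\<close>

lemma path_imp_halts:
  "successively (edge P) ls \<Longrightarrow> ls \<noteq> [] \<Longrightarrow> hd ls \<in> pc_letters P q \<Longrightarrow>
     run (map (letter_op P) ls) s t \<Longrightarrow> 5 \<in> set ls \<Longrightarrow> halts P q s"
proof (induction ls arbitrary: q s)
  case (Cons l ls)
  show ?case
  proof (cases "q < length P")
    case True
    then have "l \<noteq> 5" "6 \<le> l" "(l - 6) div 2 = q" using Cons.prems(3)
      by (auto simp: pc_letters_def split: instr.splits)
    moreover from this Cons.prems have "ls \<noteq> []" by auto
    ultimately obtain u where u: "exec (letter_op P l) s u" "run (map (letter_op P) ls) u t"
      and ls: "successively (edge P) ls" "ls \<noteq> []" "hd ls \<in> pc_letters P (target P l)" "5 \<in> set ls"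
      using Cons.prems
      by (auto simp: successively_Cons edge_pc)
    have halts: "halts P (target P l) u" by (rule Cons.IH) (use u ls in auto)
    show ?thesis
    proof (cases "P ! q")
      case (INC r q')
      then show ?thesis using halts u(1) True Cons.prems(3)
        by (auto simp: target_def letter_op_def pc_letters_def intro: halts_INC)
    next
      case (DJZ r q' q'')
      then show ?thesis using halts u(1) True Cons.prems(3)
        by (auto simp: target_def letter_op_def pc_letters_def intro: halts_dec halts_zero)
    qed
  qed (simp add: halts_end)
qed simp

definition input_letters :: "nat \<Rightarrow> nat \<Rightarrow> nat list" where
  "input_letters a c = replicate a 2 @ replicate c 3 @ [4]"

lemma successively_input_letters:
  "successively (edge P) (1 # input_letters a c @ ls) \<longleftrightarrow>
     ls = [] \<or> successively (edge P) ls \<and> hd ls \<in> pc_letters P 0"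
proof -
  \<comment> \<open>The preceding letter \<open>x\<close> is generalised because the induction peels
    letters off the front.\<close>
  have 3: "successively (edge P) (x # replicate c 3 @ 4 # ls) \<longleftrightarrow> successively (edge P) (4 # ls)"
    if "x \<in> {1, 2, 3}" for x c
    using that by (induction c arbitrary: x) (auto simp: edge_input)
  have "successively (edge P) (x # replicate a 2 @ replicate c 3 @ 4 # ls)
      \<longleftrightarrow> successively (edge P) (4 # ls)" if "x \<in> {1, 2}" for x
    using that by (induction a arbitrary: x) (auto simp: edge_input 3)
  then show ?thesis
    by (auto simp: input_letters_def successively_Cons edge_pc target_def)
qed

text \<open>The input letters load the first two counters and lead to address 0, so only the
  remaining path has to be compared with the machine. It is nonempty because 5 is not an input
  letter.\<close>

lemma path_iff_halts:
  "(\<exists>ls t. successively (edge P) (1 # input_letters a c @ ls) \<and>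
      run (map (letter_op P) (1 # input_letters a c @ ls)) (\<lambda>_. 0) t \<and>
      5 \<in> set (1 # input_letters a c @ ls)) \<longleftrightarrow>
    halts P 0 ((\<lambda>_. 0)(0 := a, 1 := c))" (is "?L \<longleftrightarrow> halts P 0 ?s")
proof -
  have "run (map (letter_op P) (1 # input_letters a c @ ls)) (\<lambda>_. 0) t
      \<longleftrightarrow> run (map (letter_op P) ls) ?s t" for ls t
    by (auto simp: input_letters_def run_append run_replicate_Incr letter_op_def)
  moreover have "5 \<in> set (1 # input_letters a c @ ls) \<longleftrightarrow> 5 \<in> set ls" for ls
    by (auto simp: input_letters_def)
  ultimately have "?L \<longleftrightarrow> (\<exists>ls t. (ls = [] \<or> successively (edge P) ls \<and> hd ls \<in> pc_letters P 0) \<and>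
      run (map (letter_op P) ls) ?s t \<and> 5 \<in> set ls)"
    by (simp only: successively_input_letters)
  also have "\<dots> \<longleftrightarrow> halts P 0 ?s"
    using halts_imp_path[of P 0 ?s] path_imp_halts[of P _ 0 ?s] by (metis empty_iff list.set(1))
  finally show ?thesis .
qed

section \<open>Formulas\<close>

text \<open>\<open>Shared x\<close> is always false and serves as the empty disjunction with free
  variable \<open>x\<close>.\<close>

definition any_of :: "'a list \<Rightarrow> var \<Rightarrow> 'a fo2" where
  "any_of ls x = foldr (\<lambda>a. Disj (Act a x)) ls (Shared x)"

definition some_at :: "'a list \<Rightarrow> var \<Rightarrow> 'a fo2 \<Rightarrow> 'a fo2" where
  "some_at ls x \<phi> = Exists x (Conj (any_of ls x) \<phi>)"

text \<open>Here the empty disjunction is a closed false formula, so a disjunction of sentences is a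
  sentence.\<close>

definition any_formula :: "'a fo2 list \<Rightarrow> 'a fo2" where
  "any_formula \<phi>s = foldr Disj \<phi>s (Exists Vx (Shared Vx))"

text \<open>The equality \<open>x = y\<close> below renames the free variable, so that the same step can be iterated
  and the code of the formula is obtained by iterating a single function.\<close>

fun letters_after :: "'a list \<Rightarrow> 'a fo2" where
  "letters_after [] = Eq Vx Vx"
| "letters_after (l # ls) = Exists Vy (Conj (Conj (Suc_of Vy Vx) (Act l Vy))
     (Exists Vx (Conj (Eq Vx Vy) (letters_after ls))))"

lemma sat_any_of [simp]:
  "sat P\<^sub>S P\<^sub>E w \<nu> (any_of ls x) \<longleftrightarrow> (\<exists>i \<in> positions w. \<nu> x = Pos i \<and> fst (letter_at w i) \<in> set ls)"
  unfolding any_of_def by (induction ls) auto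

lemma sat_some_at [simp]:
  "sat P\<^sub>S P\<^sub>E w \<nu> (some_at ls x \<phi>) \<longleftrightarrow>
     (\<exists>i \<in> positions w. fst (letter_at w i) \<in> set ls \<and> sat P\<^sub>S P\<^sub>E w (\<nu>(x := Pos i)) \<phi>)"
  unfolding some_at_def by (auto simp: dom_of_def)

lemma sat_any_formula [simp]:
  "sat P\<^sub>S P\<^sub>E w \<nu> (any_formula \<phi>s) \<longleftrightarrow> (\<exists>\<phi> \<in> set \<phi>s. sat P\<^sub>S P\<^sub>E w \<nu> \<phi>)"
  unfolding any_formula_def by (induction \<phi>s) auto

lemma sat_letters_after:
  "\<nu> Vx = Pos i \<Longrightarrow> sat P\<^sub>S P\<^sub>E w \<nu> (letters_after ls) \<longleftrightarrow>
     (\<forall>j < length ls. Suc (i + j) \<in> positions w \<and> fst (letter_at w (Suc (i + j))) = ls ! j)"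
proof (induction ls arbitrary: \<nu> i)
  case (Cons l ls)
  have "sat P\<^sub>S P\<^sub>E w \<nu> (letters_after (l # ls)) \<longleftrightarrow>
      Suc i \<in> positions w \<and> fst (letter_at w (Suc i)) = l \<and>
      sat P\<^sub>S P\<^sub>E w (\<nu>(Vy := Pos (Suc i), Vx := Pos (Suc i))) (letters_after ls)"
    using Cons.prems by (auto simp: dom_of_def)
  then show ?case by (simp add: Cons.IH[of _ "Suc i"] All_less_Suc2)
qed simp

lemma free_vars_any_of [simp]: "free_vars (any_of ls x) = {x}"
  unfolding any_of_def by (induction ls) auto

lemma free_vars_some_at [simp]: "free_vars (some_at ls x \<phi>) = free_vars \<phi> - {x}"
  by (auto simp: some_at_def)

lemma free_vars_any_formula [simp]: "free_vars (any_formula \<phi>s) = (\<Union>\<phi> \<in> set \<phi>s. free_vars \<phi>)"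
  unfolding any_formula_def by (induction \<phi>s) auto

lemma free_vars_letters_after [simp]: "free_vars (letters_after ls) = {Vx}"
  by (induction ls) auto

lemma set_any_of [simp]: "set_fo2 (any_of ls x) = set ls"
  unfolding any_of_def by (induction ls) auto

lemma set_some_at [simp]: "set_fo2 (some_at ls x \<phi>) = set ls \<union> set_fo2 \<phi>"
  by (auto simp: some_at_def)

lemma set_any_formula [simp]: "set_fo2 (any_formula \<phi>s) = (\<Union>\<phi> \<in> set \<phi>s. set_fo2 \<phi>)"
  unfolding any_formula_def by (induction \<phi>s) auto

lemma set_letters_after [simp]: "set_fo2 (letters_after ls) = set ls"
  by (induction ls) auto

lemma positions_downward_closed: "i \<in> positions w \<Longrightarrow> j \<le> i \<Longrightarrow> j \<in> positions w"
  by (cases w) auto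

lemma length_pref [simp]: "length (pref w n) = n"
  by (simp add: pref_def)

lemma nth_pref [simp]: "i < n \<Longrightarrow> pref w n ! i = letter_at w i"
  by (simp add: pref_def)

lemma take_pref: "i \<le> n \<Longrightarrow> take i (pref w n) = pref w i"
  by (rule nth_equalityI) auto

lemma distinct_map_filter_conv_nth:
  "distinct (map f (filter P xs)) \<longleftrightarrow>
     (\<forall>i < length xs. \<forall>j < length xs. P (xs ! i) \<longrightarrow> P (xs ! j) \<longrightarrow> f (xs ! i) = f (xs ! j) \<longrightarrow> i = j)"
proof (induction xs)
  case (Cons x xs)
  then show ?case by (auto simp: All_less_Suc2 image_iff in_set_conv_nth)
qed simp

section \<open>Plays\<close>

text \<open>The first condition of compatibility for a finite history, before it is extended to a
  full play.\<close>

definition follows :: "'a set \<Rightarrow> 'p set \<Rightarrow> ('a, 'p) strategy \<Rightarrow> ('a, 'p) letter list \<Rightarrow> bool" where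
  "follows A\<^sub>S P\<^sub>S S v \<longleftrightarrow>
     (\<forall>i < length v. v ! i \<in> A\<^sub>S \<times> P\<^sub>S \<longrightarrow> S (take i v) = Some (v ! i))"

lemma follows_snoc: "follows A\<^sub>S P\<^sub>S S (v @ [\<sigma>]) \<longleftrightarrow>
    follows A\<^sub>S P\<^sub>S S v \<and> (\<sigma> \<in> A\<^sub>S \<times> P\<^sub>S \<longrightarrow> S v = Some \<sigma>)"
  unfolding follows_def by (simp add: All_less_Suc nth_append conj_commute)

text \<open>System plays on alone after the history \<open>v\<close>; once it passes, the word no
  longer changes.\<close>

fun play :: "('a, 'p) strategy \<Rightarrow> ('a, 'p) letter list \<Rightarrow> nat \<Rightarrow> ('a, 'p) letter list" where
  "play S v 0 = v"
| "play S v (Suc n) = (case S (play S v n) of None \<Rightarrow> play S v n | Some \<sigma> \<Rightarrow> play S v n @ [\<sigma>])"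

lemma nth_play: "m \<le> n \<Longrightarrow> i < length (play S v m) \<Longrightarrow>
    i < length (play S v n) \<and> play S v n ! i = play S v m ! i"
  by (induction n rule: dec_induct) (auto split: option.split simp: nth_append)

lemma length_play: "\<forall>n. S (play S v n) \<noteq> None \<Longrightarrow> length (play S v n) = length v + n"
  by (induction n) (auto split: option.split)

lemma play_follows:
  assumes "S \<in> strategies A\<^sub>S A\<^sub>E P\<^sub>S P\<^sub>E" "v \<in> lists (A\<^sub>S \<times> P\<^sub>S \<union> A\<^sub>E \<times> P\<^sub>E)" "follows A\<^sub>S P\<^sub>S S v"
  shows "play S v n \<in> lists (A\<^sub>S \<times> P\<^sub>S \<union> A\<^sub>E \<times> P\<^sub>E) \<and> follows A\<^sub>S P\<^sub>S S (play S v n) \<and>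
    (\<forall>i < length (play S v n). length v \<le> i \<longrightarrow> play S v n ! i \<in> A\<^sub>S \<times> P\<^sub>S)"
proof (induction n)
  case (Suc n)
  show ?case
  proof (cases "S (play S v n)")
    case None
    then show ?thesis using Suc by simp
  next
    case (Some \<sigma>)
    have "S (play S v n) \<in> insert None (Some ` (A\<^sub>S \<times> P\<^sub>S))"
      using assms(1) Suc by (simp add: strategies_def)
    with Some have "\<sigma> \<in> A\<^sub>S \<times> P\<^sub>S" by auto
    with Some Suc show ?thesis by (simp add: follows_snoc All_less_Suc nth_append)
  qed
qed (use assms in auto)

text \<open>Environment stays silent after \<open>v\<close>. If System passes at some stage, the
  word reached is a finite compatible play. Otherwise the stages converge to an infinite word whose
  letters after \<open>v\<close> are all System's, and such a word is fair.\<close>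

lemma play_extends:
  assumes S: "S \<in> strategies A\<^sub>S A\<^sub>E P\<^sub>S P\<^sub>E" and v: "v \<in> lists (A\<^sub>S \<times> P\<^sub>S \<union> A\<^sub>E \<times> P\<^sub>E)" "follows A\<^sub>S P\<^sub>S S v"
  obtains w where "w \<in> data_words A\<^sub>S A\<^sub>E P\<^sub>S P\<^sub>E" "compatible A\<^sub>S P\<^sub>S S w" "fair A\<^sub>S P\<^sub>S S w"
    "\<And>i. i < length v \<Longrightarrow> i \<in> positions w \<and> letter_at w i = v ! i"
    "\<And>i. i \<in> positions w \<Longrightarrow> length v \<le> i \<Longrightarrow> letter_at w i \<in> A\<^sub>S \<times> P\<^sub>S"
proof (cases "\<exists>n. S (play S v n) = None")
  case True
  then obtain n where n: "S (play S v n) = None" by blast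
  let ?u = "play S v n"
  have pref: "pref (FinSeq ?u) i = take i ?u" if "i < length ?u" for i
    by (rule nth_equalityI) (use that in auto)
  note inv = play_follows[OF S v, of n]
  show ?thesis
  proof (rule that[of "FinSeq ?u"])
    have "?u ! i \<in> A\<^sub>S \<times> P\<^sub>S \<union> A\<^sub>E \<times> P\<^sub>E" if "i < length ?u" for i
      using inv nth_mem[OF that] by blast
    then show "FinSeq ?u \<in> data_words A\<^sub>S A\<^sub>E P\<^sub>S P\<^sub>E" by (simp add: data_words_def)
    show "compatible A\<^sub>S P\<^sub>S S (FinSeq ?u)" using inv n by (auto simp: compatible_def follows_def pref)
    show "fair A\<^sub>S P\<^sub>S S (FinSeq ?u)" by (simp add: fair_def)
  qed (use nth_play[of 0 n _ S v] inv in auto)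
next
  case False
  then have len: "length (play S v n) = length v + n" for n using False length_play[of S v] by simp
  \<comment> \<open>Stage \<open>Suc i\<close> has length at least \<open>Suc i\<close>, so position
    \<open>i\<close> is filled there, and later stages do not alter it.\<close>
  define s where "s i = play S v (Suc i) ! i" for i
  have s: "play S v n ! i = s i" if "i < length v + n" for i n
    using nth_play[of n "Suc i" i S v] nth_play[of "Suc i" n i S v] that
    by (cases "n \<le> Suc i") (auto simp: s_def len simp del: play.simps)
  have pref: "pref (InfSeq s) i = take i (play S v i)" for i
    by (rule nth_equalityI) (auto simp: len s)
  have sys: "s i \<in> A\<^sub>S \<times> P\<^sub>S" if "length v \<le> i" for i
    using play_follows[OF S v, of "Suc i"] that unfolding s_def len by simp
  show ?thesis
  proof (rule that[of "InfSeq s"])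
    have "s i \<in> A\<^sub>S \<times> P\<^sub>S \<union> A\<^sub>E \<times> P\<^sub>E" for i
      using play_follows[OF S v, of "Suc i"] nth_mem[of i "play S v (Suc i)"] unfolding s_def len
      by (simp add: in_lists_conv_set del: play.simps)
    then show "InfSeq s \<in> data_words A\<^sub>S A\<^sub>E P\<^sub>S P\<^sub>E" by (simp add: data_words_def)
    have "S (take i (play S v i)) = Some (s i)" if "s i \<in> A\<^sub>S \<times> P\<^sub>S" for i
    proof -
      have "take i (play S v (Suc i)) = take i (play S v i)"
        by (rule nth_equalityI) (auto simp: len s simp del: play.simps)
      moreover have "follows A\<^sub>S P\<^sub>S S (play S v (Suc i))" using play_follows[OF S v] by blast
      ultimately show ?thesis
        using that unfolding follows_def by (simp add: len s del: play.simps) (metis le_add2 less_Suc_eq_le)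
    qed
    then show "compatible A\<^sub>S P\<^sub>S S (InfSeq s)" by (simp add: compatible_def pref)
    have "infinite {length v..}" by (rule infinite_Ici)
    then have "infinite {i. s i \<in> A\<^sub>S \<times> P\<^sub>S}" by (rule infinite_super[rotated]) (use sys in auto)
    then show "fair A\<^sub>S P\<^sub>S S (InfSeq s)" by (simp add: fair_def)
  qed (use s[of _ 0] sys in auto)
qed

section \<open>Basic conditions on words expressed in the logic\<close>

definition two_stops :: "nat fo2" where
  "two_stops = some_at [0] Vx (some_at [0] Vy (Neg (Eq Vx Vy)))"

definition stopped :: "nat fo2" where
  "stopped = some_at [0] Vx (Eq Vx Vx)"

definition same_process :: "'a list \<Rightarrow> 'a fo2" where
  "same_process ls = some_at ls Vx (some_at ls Vy (Conj (Sim Vx Vy) (Neg (Eq Vx Vy))))"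

definition unmatched :: "'a list \<Rightarrow> 'a list \<Rightarrow> 'a fo2" where
  "unmatched ls ms = some_at ls Vx (Neg (some_at ms Vy (Sim Vx Vy)))"

definition adjacent :: "'a list \<Rightarrow> 'a list \<Rightarrow> 'a fo2" where
  "adjacent ls ms = some_at ls Vx (some_at ms Vy (Suc_of Vy Vx))"

definition first_in :: "'a list \<Rightarrow> 'a fo2" where
  "first_in ls = some_at ls Vx (Neg (Exists Vy (Suc_of Vx Vy)))"

text \<open>Stopped plays are exempt, as Environment may stop before the input is complete.\<close>

definition input_formula :: "nat \<Rightarrow> nat list \<Rightarrow> nat fo2" where
  "input_formula b cs = Disj stopped (some_at [b] Vx (letters_after cs))"

lemma sat_two_stops: "sat P\<^sub>S P\<^sub>E w \<nu> two_stops \<longleftrightarrow>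
    (\<exists>i \<in> positions w. \<exists>j \<in> positions w. i \<noteq> j \<and> fst (letter_at w i) = 0 \<and> fst (letter_at w j) = 0)"
  by (auto simp: two_stops_def)

lemma sat_stopped: "sat P\<^sub>S P\<^sub>E w \<nu> stopped \<longleftrightarrow> (\<exists>i \<in> positions w. fst (letter_at w i) = 0)"
  by (auto simp: stopped_def)

lemma sat_same_process: "sat P\<^sub>S P\<^sub>E w \<nu> (same_process ls) \<longleftrightarrow>
    (\<exists>i \<in> positions w. \<exists>j \<in> positions w. i \<noteq> j \<and> fst (letter_at w i) \<in> set ls \<and>
       fst (letter_at w j) \<in> set ls \<and> snd (letter_at w i) = snd (letter_at w j))"
  by (auto simp: same_process_def)

lemma sat_unmatched: "sat P\<^sub>S P\<^sub>E w \<nu> (unmatched ls ms) \<longleftrightarrow>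
    (\<exists>i \<in> positions w. fst (letter_at w i) \<in> set ls \<and>
       (\<forall>j \<in> positions w. fst (letter_at w j) \<in> set ms \<longrightarrow> snd (letter_at w i) \<noteq> snd (letter_at w j)))"
  by (auto simp: unmatched_def)

lemma sat_adjacent: "sat P\<^sub>S P\<^sub>E w \<nu> (adjacent ls ms) \<longleftrightarrow>
    (\<exists>i. Suc i \<in> positions w \<and> fst (letter_at w i) \<in> set ls \<and> fst (letter_at w (Suc i)) \<in> set ms)"
  using positions_downward_closed[of _ w] by (fastforce simp: adjacent_def)

lemma sat_first_in: "sat P\<^sub>S P\<^sub>E w \<nu> (first_in ls) \<longleftrightarrow>
    0 \<in> positions w \<and> fst (letter_at w 0) \<in> set ls"
proof -
  have "(\<exists>d \<in> dom_of P\<^sub>S P\<^sub>E w. \<exists>j. d = Pos j \<and> i = Suc j) \<longleftrightarrow> i \<noteq> 0" if "i \<in> positions w" for i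
    using positions_downward_closed[OF that, of "i - 1"] by (auto simp: dom_of_def gr0_conv_Suc)
  then show ?thesis by (fastforce simp: first_in_def)
qed

lemma sat_input_formula: "sat P\<^sub>S P\<^sub>E w \<nu> (input_formula b cs) \<longleftrightarrow>
    (\<exists>i \<in> positions w. fst (letter_at w i) = 0) \<or>
    (\<exists>i \<in> positions w. fst (letter_at w i) = b \<and>
      (\<forall>j < length cs. Suc (i + j) \<in> positions w \<and> fst (letter_at w (Suc (i + j))) = cs ! j))"
  by (auto simp: input_formula_def sat_stopped sat_letters_after)

definition is_incr :: "counter_op \<Rightarrow> bool" where "is_incr c \<longleftrightarrow> (\<exists>r. c = Incr r)"
definition is_decr :: "counter_op \<Rightarrow> bool" where "is_decr c \<longleftrightarrow> (\<exists>r. c = Decr r)"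

section \<open>The game of a labelled graph\<close>

text \<open>\<open>R\<close> bounds the counters so that \<open>violations\<close> is a finite list.
  The condition \<open>m \<noteq> b\<close> confines \<open>b\<close> to the first position of a
  path, which anchors the input at the beginning.\<close>

locale counter_graph =
  fixes L :: "nat list" and op :: "nat \<Rightarrow> counter_op" and E :: "nat \<Rightarrow> nat \<Rightarrow> bool"
    and b h R :: nat
  assumes zero_notin: "0 \<notin> set L" and b_in: "b \<in> set L" and h_in: "h \<in> set L"
    and edge: "E l m \<Longrightarrow> m \<in> set L \<and> m \<noteq> b"
    and bound: "l \<in> set L \<Longrightarrow> op l \<in> {Incr r, Decr r, Zero r} \<Longrightarrow> r < R"
begin

text \<open>\<open>adjacent [0] L\<close> forbids System to move right after a stop. The last clause
  inspects only a zero test immediately before the stop letter; all zero tests are covered because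
  Environment may stop at any moment.\<close>

definition violations :: "nat fo2 list" where
  "violations =
     [first_in (filter (\<lambda>l. l \<noteq> b) L), adjacent [0] L,
      same_process (filter (is_incr \<circ> op) L), same_process (filter (is_decr \<circ> op) L)]
     @ map (\<lambda>l. adjacent [l] (filter (\<lambda>m. \<not> E l m) L)) L
     @ map (\<lambda>r. unmatched (filter (\<lambda>l. op l = Decr r) L) (filter (\<lambda>l. op l = Incr r) L)) [0..<R]
     @ map (\<lambda>r. Conj (adjacent (filter (\<lambda>l. op l = Zero r) L) [0])
         (unmatched (filter (\<lambda>l. op l = Incr r) L) (filter (\<lambda>l. op l = Decr r) L))) [0..<R]"

text \<open>Environment forfeits by stopping twice. \<open>Exists Vx (Env Vx)\<close> excludes an
  empty \<open>P\<^sub>E\<close>, with which no stop could be played and the prefixes of the run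
  would go unchecked.\<close>

definition graph_formula :: "nat fo2" where
  "graph_formula = Disj two_stops (Conj (Exists Vx (Env Vx)) (Conj (Neg (any_formula violations))
     (Disj stopped (some_at [h] Vx (Eq Vx Vx)))))"

lemma sat_graph_formula: "sat P\<^sub>S P\<^sub>E w \<nu> graph_formula \<longleftrightarrow>
    (\<exists>i \<in> positions w. \<exists>j \<in> positions w. i \<noteq> j \<and> fst (letter_at w i) = 0 \<and> fst (letter_at w j) = 0) \<or>
    P\<^sub>E \<noteq> {} \<and> \<not> (\<exists>\<phi> \<in> set violations. sat P\<^sub>S P\<^sub>E w \<nu> \<phi>) \<and>
    ((\<exists>i \<in> positions w. fst (letter_at w i) = 0) \<or> (\<exists>i \<in> positions w. fst (letter_at w i) = h))"
proof -
  have "(\<exists>d \<in> dom_of P\<^sub>S P\<^sub>E w. d \<in> Proc ` P\<^sub>E) \<longleftrightarrow> P\<^sub>E \<noteq> {}" by (auto simp: dom_of_def)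
  then show ?thesis by (simp add: graph_formula_def sat_two_stops sat_stopped)
qed

lemma graph_formula_sentence:
  assumes "set cs \<subseteq> set L"
  shows "Conj graph_formula (input_formula b cs) \<in> sentences (set L \<union> {0})"
  using assms b_in h_in
  by (auto simp: sentences_def graph_formula_def violations_def input_formula_def two_stops_def stopped_def
      same_process_def unmatched_def adjacent_def first_in_def)

definition incremented :: "(nat \<times> 'p) list \<Rightarrow> nat \<Rightarrow> 'p set" where
  "incremented u r = snd ` {x \<in> set u. op (fst x) = Incr r}"

definition decremented :: "(nat \<times> 'p) list \<Rightarrow> nat \<Rightarrow> 'p set" where
  "decremented u r = snd ` {x \<in> set u. op (fst x) = Decr r}"

definition consistent :: "(nat \<times> 'p) list \<Rightarrow> bool" where
  "consistent u \<longleftrightarrow> (u \<noteq> [] \<longrightarrow> fst (hd u) = b) \<and> successively E (map fst u) \<and>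
     distinct (map snd (filter (\<lambda>x. is_incr (op (fst x))) u)) \<and>
     distinct (map snd (filter (\<lambda>x. is_decr (op (fst x))) u)) \<and>
     (\<forall>r. decremented u r \<subseteq> incremented u r)"

definition zero_tested :: "(nat \<times> 'p) list \<Rightarrow> bool" where
  "zero_tested u \<longleftrightarrow> (\<forall>r. u \<noteq> [] \<longrightarrow> op (fst (last u)) = Zero r \<longrightarrow> incremented u r \<subseteq> decremented u r)"

text \<open>The word \<open>w\<close> is \<open>u\<close>, possibly followed by a single stop letter.\<close>

lemma sat_violations:
  assumes u: "\<And>i. i < length u \<Longrightarrow> i \<in> positions w \<and> letter_at w i = u ! i \<and> fst (u ! i) \<in> set L"
    and w: "\<And>i. i \<in> positions w \<Longrightarrow> i < length u \<or> i = length u \<and> fst (letter_at w i) = 0"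
  shows "(\<exists>\<phi> \<in> set violations. sat P\<^sub>S P\<^sub>E w \<nu> \<phi>) \<longleftrightarrow>
    \<not> (consistent u \<and> (length u \<in> positions w \<longrightarrow> zero_tested u))"
proof -
  \<comment> \<open>The stop letter is not in \<open>L\<close>, so positions carrying letters of
    \<open>L\<close> are exactly the indices of \<open>u\<close>; the clauses are translated through
    this.\<close>
  have L: "i \<in> positions w \<and> fst (letter_at w i) \<in> set (filter Q L) \<longleftrightarrow> i < length u \<and> Q (fst (u ! i))" for i Q
    using u[of i] w[of i] zero_notin by auto
  have first: "sat P\<^sub>S P\<^sub>E w \<nu> (first_in (filter (\<lambda>l. l \<noteq> b) L)) \<longleftrightarrow> \<not> (u \<noteq> [] \<longrightarrow> fst (hd u) = b)"
    unfolding sat_first_in L by (auto simp: hd_conv_nth)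
  have late: "\<not> sat P\<^sub>S P\<^sub>E w \<nu> (adjacent [0] L)"
  proof
    assume "sat P\<^sub>S P\<^sub>E w \<nu> (adjacent [0] L)"
    then obtain i where "Suc i \<in> positions w" "fst (letter_at w i) = 0" "fst (letter_at w (Suc i)) \<in> set L"
      by (auto simp: sat_adjacent)
    then show False using w[of "Suc i"] u[of i] zero_notin by auto
  qed
  have process: "sat P\<^sub>S P\<^sub>E w \<nu> (same_process (filter Q L)) \<longleftrightarrow>
      \<not> distinct (map snd (filter (\<lambda>x. Q (fst x)) u))" for Q
  proof -
    have "sat P\<^sub>S P\<^sub>E w \<nu> (same_process (filter Q L)) \<longleftrightarrow>
        (\<exists>i j. (i \<in> positions w \<and> fst (letter_at w i) \<in> set (filter Q L)) \<and>
          (j \<in> positions w \<and> fst (letter_at w j) \<in> set (filter Q L)) \<and> i \<noteq> j \<and>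
          snd (letter_at w i) = snd (letter_at w j))"
      unfolding sat_same_process by blast
    also have "\<dots> \<longleftrightarrow> (\<exists>i j. (i < length u \<and> Q (fst (u ! i))) \<and> (j < length u \<and> Q (fst (u ! j))) \<and>
        i \<noteq> j \<and> snd (u ! i) = snd (u ! j))"
      unfolding L using u by (intro iff_exI conj_cong) auto
    finally show ?thesis unfolding distinct_map_filter_conv_nth by blast
  qed
  have edges: "(\<exists>l \<in> set L. sat P\<^sub>S P\<^sub>E w \<nu> (adjacent [l] (filter (\<lambda>m. \<not> E l m) L))) \<longleftrightarrow>
      \<not> successively E (map fst u)"
  proof -
    have "(\<exists>l \<in> set L. sat P\<^sub>S P\<^sub>E w \<nu> (adjacent [l] (filter (\<lambda>m. \<not> E l m) L))) \<longleftrightarrow>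
        (\<exists>i. fst (letter_at w i) \<in> set L \<and> (Suc i \<in> positions w \<and>
          fst (letter_at w (Suc i)) \<in> set (filter (\<lambda>m. \<not> E (fst (letter_at w i)) m) L)))"
      unfolding sat_adjacent by auto
    also have "\<dots> \<longleftrightarrow> (\<exists>i. Suc i < length u \<and> \<not> E (fst (u ! i)) (fst (u ! Suc i)))"
      unfolding L using u Suc_lessD by (intro iff_exI) metis
    finally show ?thesis by (auto simp: successively_conv_nth)
  qed
  have unmatched: "sat P\<^sub>S P\<^sub>E w \<nu> (unmatched (filter Q L) (filter Q' L)) \<longleftrightarrow>
      \<not> snd ` {x \<in> set u. Q (fst x)} \<subseteq> snd ` {x \<in> set u. Q' (fst x)}" for Q Q'
  proof -
    have img: "p \<in> snd ` {x \<in> set u. Q (fst x)} \<longleftrightarrow> (\<exists>i. (i < length u \<and> Q (fst (u ! i))) \<and> p = snd (u ! i))"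
      for p Q unfolding image_iff mem_Collect_eq bex_simps Bex_def in_set_conv_nth by metis
    have "sat P\<^sub>S P\<^sub>E w \<nu> (unmatched (filter Q L) (filter Q' L)) \<longleftrightarrow>
        (\<exists>i. (i \<in> positions w \<and> fst (letter_at w i) \<in> set (filter Q L)) \<and>
          (\<forall>j. (j \<in> positions w \<and> fst (letter_at w j) \<in> set (filter Q' L)) \<longrightarrow>
            snd (letter_at w i) \<noteq> snd (letter_at w j)))"
      unfolding sat_unmatched by blast
    also have "\<dots> \<longleftrightarrow> (\<exists>i. (i < length u \<and> Q (fst (u ! i))) \<and>
        (\<forall>j. (j < length u \<and> Q' (fst (u ! j))) \<longrightarrow> snd (u ! i) \<noteq> snd (u ! j)))"
      unfolding L using u by (intro iff_exI conj_cong iff_allI imp_cong) auto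
    finally show ?thesis unfolding subset_iff img by metis
  qed
  have zero: "sat P\<^sub>S P\<^sub>E w \<nu> (adjacent (filter (\<lambda>l. op l = Zero r) L) [0]) \<longleftrightarrow>
      length u \<in> positions w \<and> u \<noteq> [] \<and> op (fst (last u)) = Zero r" for r
  proof -
    have eq: "Suc i \<in> positions w \<and> fst (letter_at w i) \<in> set (filter Q L) \<and>
          fst (letter_at w (Suc i)) \<in> set [0] \<longleftrightarrow>
        Suc i = length u \<and> Suc i \<in> positions w \<and> Q (fst (u ! i))" for i Q
      using u[of i] w[of "Suc i"] u[of "Suc i"] zero_notin by fastforce
    show ?thesis unfolding sat_adjacent eq
      by (cases u rule: rev_cases) (auto simp: last_conv_nth)
  qed
  \<comment> \<open>A counter violating the inclusion occurs in \<open>u\<close> and hence lies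
    below \<open>R\<close>, so the bounded quantifier loses nothing.\<close>
  have decr: "(\<exists>r\<in>{0..<R}. \<not> decremented u r \<subseteq> incremented u r) \<longleftrightarrow> (\<exists>r. \<not> decremented u r \<subseteq> incremented u r)"
  proof -
    have "r < R" if ne: "\<not> decremented u r \<subseteq> incremented u r" for r
    proof -
      obtain x where "x \<in> set u" "op (fst x) = Decr r" using ne unfolding decremented_def by blast
      then show ?thesis using u bound[of "fst x" r] by (metis in_set_conv_nth insert_iff)
    qed
    then show ?thesis unfolding Bex_def atLeastLessThan_iff by blast
  qed
  have zeros: "(\<exists>r\<in>{0..<R}. u \<noteq> [] \<and> op (fst (last u)) = Zero r \<and> \<not> incremented u r \<subseteq> decremented u r) \<longleftrightarrow>
      \<not> zero_tested u"
  proof -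
    have "r < R" if ne: "\<not> incremented u r \<subseteq> decremented u r" for r
    proof -
      obtain x where "x \<in> set u" "op (fst x) = Incr r" using ne unfolding incremented_def by blast
      then show ?thesis using u bound[of "fst x" r] by (metis in_set_conv_nth insert_iff)
    qed
    then show ?thesis unfolding zero_tested_def Bex_def atLeastLessThan_iff by blast
  qed
  have "(\<exists>\<phi> \<in> set violations. sat P\<^sub>S P\<^sub>E w \<nu> \<phi>) \<longleftrightarrow>
      \<not> (u \<noteq> [] \<longrightarrow> fst (hd u) = b) \<or>
      \<not> distinct (map snd (filter (\<lambda>x. is_incr (op (fst x))) u)) \<or>
      \<not> distinct (map snd (filter (\<lambda>x. is_decr (op (fst x))) u)) \<or>
      \<not> successively E (map fst u) \<or>
      (\<exists>r\<in>{0..<R}. \<not> decremented u r \<subseteq> incremented u r) \<or>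
      length u \<in> positions w \<and>
        (\<exists>r\<in>{0..<R}. u \<noteq> [] \<and> op (fst (last u)) = Zero r \<and> \<not> incremented u r \<subseteq> decremented u r)"
    unfolding violations_def set_append set_map bex_Un edges[symmetric]
    by (simp add: first late process unmatched zero incremented_def decremented_def o_def) argo
  then show ?thesis unfolding decr zeros consistent_def by blast
qed

end

section \<open>Words legal at every prefix, and the counter values they represent\<close>

context counter_graph
begin

text \<open>The inclusion in \<open>consistent\<close> ignores order; imposed on all prefixes, it
  puts each decrement after its increment. Likewise every zero test is checked at the moment it
  occurs.\<close>

definition admissible :: "(nat \<times> 'p) list \<Rightarrow> bool" where
  "admissible u \<longleftrightarrow> (\<forall>n \<le> length u. consistent (take n u) \<and> zero_tested (take n u))"

lemma admissibleD: "admissible u \<Longrightarrow> consistent u" "admissible u \<Longrightarrow> zero_tested u"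
  unfolding admissible_def by (metis order_refl take_all)+

lemma admissible_take: "admissible u \<Longrightarrow> admissible (take n u)"
  by (auto simp: admissible_def min_def)

lemma incremented_snoc:
  "incremented (u @ [(l, p)]) r = (if op l = Incr r then insert p (incremented u r) else incremented u r)"
  by (force simp: incremented_def)

lemma decremented_snoc:
  "decremented (u @ [(l, p)]) r = (if op l = Decr r then insert p (decremented u r) else decremented u r)"
  by (force simp: decremented_def)

lemma finite_incremented [simp]: "finite (incremented u r)"
  by (simp add: incremented_def)

lemma in_map_filter_incr:
  "p \<in> snd ` set (filter (\<lambda>x. is_incr (op (fst x))) u) \<longleftrightarrow> (\<exists>r. p \<in> incremented u r)"
  by (auto simp: incremented_def is_incr_def image_iff)

lemma in_map_filter_decr:
  "p \<in> snd ` set (filter (\<lambda>x. is_decr (op (fst x))) u) \<longleftrightarrow> (\<exists>r. p \<in> decremented u r)"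
  by (auto simp: decremented_def is_decr_def image_iff)

lemma consistent_snoc:
  assumes "consistent u"
  shows "consistent (u @ [(l, p)]) \<longleftrightarrow>
    (if u = [] then l = b else E (fst (last u)) l) \<and>
    (case op l of Incr r \<Rightarrow> \<forall>r. p \<notin> incremented u r
      | Decr r \<Rightarrow> p \<in> incremented u r \<and> (\<forall>r. p \<notin> decremented u r)
      | _ \<Rightarrow> True)"
proof -
  have path: "((u @ [(l, p)] \<noteq> [] \<longrightarrow> fst (hd (u @ [(l, p)])) = b) \<and> successively E (map fst (u @ [(l, p)])))
      \<longleftrightarrow> (if u = [] then l = b else E (fst (last u)) l)"
    using assms by (auto simp: consistent_def successively_append_iff last_map)
  have incr: "distinct (map snd (filter (\<lambda>x. is_incr (op (fst x))) (u @ [(l, p)]))) \<longleftrightarrow>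
      (is_incr (op l) \<longrightarrow> (\<forall>r. p \<notin> incremented u r))"
    using assms in_map_filter_incr[of p u] by (auto simp: consistent_def)
  have decr: "distinct (map snd (filter (\<lambda>x. is_decr (op (fst x))) (u @ [(l, p)]))) \<longleftrightarrow>
      (is_decr (op l) \<longrightarrow> (\<forall>r. p \<notin> decremented u r))"
    using assms in_map_filter_decr[of p u] by (auto simp: consistent_def)
  have matched: "(\<forall>r. decremented (u @ [(l, p)]) r \<subseteq> incremented (u @ [(l, p)]) r) \<longleftrightarrow>
      (\<forall>r. op l = Decr r \<longrightarrow> p \<in> incremented u r)"
    using assms by (auto simp: consistent_def decremented_snoc incremented_snoc)
  have ops: "(is_incr (op l) \<longrightarrow> (\<forall>r. p \<notin> incremented u r)) \<and>
      (is_decr (op l) \<longrightarrow> (\<forall>r. p \<notin> decremented u r)) \<and>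
      (\<forall>r. op l = Decr r \<longrightarrow> p \<in> incremented u r) \<longleftrightarrow>
    (case op l of Incr r \<Rightarrow> \<forall>r. p \<notin> incremented u r
      | Decr r \<Rightarrow> p \<in> incremented u r \<and> (\<forall>r. p \<notin> decremented u r)
      | _ \<Rightarrow> True)"
    by (cases "op l") (simp_all add: is_incr_def is_decr_def conj_commute)
  show ?thesis
    unfolding consistent_def[of "u @ [(l, p)]"] incr decr matched ops[symmetric] path[symmetric]
    by (simp only: conj_assoc)
qed

lemma zero_tested_snoc:
  "zero_tested (u @ [(l, p)]) \<longleftrightarrow> (\<forall>r. op l = Zero r \<longrightarrow> incremented u r \<subseteq> decremented u r)"
  by (auto simp: zero_tested_def incremented_snoc decremented_snoc)

lemma admissible_Nil: "admissible []"
  by (simp add: admissible_def consistent_def zero_tested_def incremented_def decremented_def)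

text \<open>Turns the condition on all prefixes into legality of the last step, the form needed for
  induction from the right.\<close>

lemma admissible_snoc:
  "admissible (u @ [(l, p)]) \<longleftrightarrow> admissible u \<and>
    (if u = [] then l = b else E (fst (last u)) l) \<and>
    (case op l of Incr r \<Rightarrow> \<forall>r. p \<notin> incremented u r
      | Decr r \<Rightarrow> p \<in> incremented u r \<and> (\<forall>r. p \<notin> decremented u r)
      | Zero r \<Rightarrow> incremented u r \<subseteq> decremented u r
      | Nop \<Rightarrow> True)"
proof -
  have all: "(\<forall>n \<le> Suc m. Q n) \<longleftrightarrow> (\<forall>n \<le> m. Q n) \<and> Q (Suc m)" for m Q
    by (auto simp: le_Suc_eq)
  have eq: "admissible (u @ [(l, p)]) \<longleftrightarrow>
      admissible u \<and> consistent (u @ [(l, p)]) \<and> zero_tested (u @ [(l, p)])"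
    by (simp add: admissible_def all)
  show ?thesis
  proof (cases "admissible u")
    case True
    show ?thesis unfolding eq consistent_snoc[OF admissibleD(1)[OF True]] zero_tested_snoc
      using True by (auto split: counter_op.split)
  qed (simp add: eq)
qed

lemma decremented_subset: "admissible u \<Longrightarrow> decremented u r \<subseteq> incremented u r"
  using admissibleD(1) by (auto simp: consistent_def)

text \<open>By the distinctness conditions a process is incremented for at most one counter, so the
  difference below counts pending increments.\<close>

definition counters :: "(nat \<times> 'p) list \<Rightarrow> nat \<Rightarrow> nat" where
  "counters u r = card (incremented u r - decremented u r)"

text \<open>Legality makes \<open>p\<close> fresh at an increment and pending at a decrement, so the
  set of pending processes changes by exactly one element.\<close>

lemma counters_snoc:
  assumes "admissible (u @ [(l, p)])"
  shows "exec (op l) (counters u) (counters (u @ [(l, p)]))"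
proof -
  have u: "admissible u" and step: "case op l of Incr r \<Rightarrow> \<forall>r. p \<notin> incremented u r
      | Decr r \<Rightarrow> p \<in> incremented u r \<and> (\<forall>r. p \<notin> decremented u r)
      | Zero r \<Rightarrow> incremented u r \<subseteq> decremented u r
      | Nop \<Rightarrow> True"
    using assms by (auto simp: admissible_snoc)
  show ?thesis
  proof (cases "op l")
    case Nop
    then show ?thesis by (simp add: counters_def fun_eq_iff incremented_snoc decremented_snoc)
  next
    case (Incr r)
    then have p: "p \<notin> incremented u r" "p \<notin> decremented u r"
      using step decremented_subset[OF u, of r] by auto
    then have "insert p (incremented u r) - decremented u r = insert p (incremented u r - decremented u r)"
      by auto
    with p Incr show ?thesis
      by (auto simp: counters_def fun_eq_iff incremented_snoc decremented_snoc)
  next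
    case (Decr r)
    then have p: "p \<in> incremented u r" "p \<notin> decremented u r" using step by auto
    let ?D = "incremented u r - decremented u r"
    have "incremented u r - insert p (decremented u r) = ?D - {p}" by auto
    moreover have "card ?D = Suc (card (?D - {p}))"
      using p by (intro card.remove) auto
    ultimately show ?thesis using Decr
      by (auto simp: counters_def fun_eq_iff incremented_snoc decremented_snoc)
  next
    case (Zero r)
    then have "incremented u r - decremented u r = {}" using step by auto
    then have "counters u r = 0" unfolding counters_def by simp
    with Zero show ?thesis by (simp add: counters_def fun_eq_iff incremented_snoc decremented_snoc)
  qed
qed

lemma run_counters: "admissible u \<Longrightarrow> run (map (op \<circ> fst) u) (\<lambda>_. 0) (counters u)"
proof (induction u rule: rev_induct)
  case Nil
  show ?case by (simp add: counters_def incremented_def fun_eq_iff)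
next
  case (snoc x u)
  then show ?case
    using counters_snoc[of u "fst x" "snd x"] admissible_snoc[of u "fst x" "snd x"]
    by (auto simp: run_append)
qed

text \<open>Processes are picked greedily: a fresh one for each increment, any pending one for each
  decrement. A positive counter value guarantees a pending one.\<close>

lemma ex_admissible:
  assumes "successively E ls" "ls \<noteq> [] \<Longrightarrow> hd ls = b" "run (map op ls) (\<lambda>_. 0) t"
  shows "\<exists>u :: (nat \<times> nat) list. map fst u = ls \<and> admissible u \<and> counters u = t"
  using assms
proof (induction ls arbitrary: t rule: rev_induct)
  case Nil
  then show ?case by (intro exI[of _ "[]"]) (simp add: admissible_Nil counters_def incremented_def fun_eq_iff)
next
  case (snoc l ls)
  obtain s where s: "run (map op ls) (\<lambda>_. 0) s" "exec (op l) s t"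
    using snoc.prems(3) by (auto simp: run_append)
  have "successively E ls" "ls \<noteq> [] \<Longrightarrow> hd ls = b"
    using snoc.prems(1,2) by (auto simp: successively_append_iff)
  from snoc.IH[OF this s(1)] obtain u :: "(nat \<times> nat) list"
    where u: "map fst u = ls" "admissible u" "counters u = s" by blast
  have edge: "if u = [] then l = b else E (fst (last u)) l"
    using snoc.prems(1,2) u(1) by (auto simp: successively_append_iff last_map)
  have "\<exists>p. case op l of Incr r \<Rightarrow> \<forall>r. p \<notin> incremented u r
      | Decr r \<Rightarrow> p \<in> incremented u r \<and> (\<forall>r. p \<notin> decremented u r)
      | Zero r \<Rightarrow> incremented u r \<subseteq> decremented u r
      | Nop \<Rightarrow> True"
  proof (cases "op l")
    case Nop
    then show ?thesis by simp
  next
    case (Incr r)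
    obtain p where "p \<notin> snd ` set u" using ex_new_if_finite[of "snd ` set u"] by auto
    then show ?thesis using Incr by (auto simp: incremented_def)
  next
    case (Decr r)
    then have "counters u r \<noteq> 0" using s(2) u(3) by auto
    then have "incremented u r - decremented u r \<noteq> {}" unfolding counters_def by (metis card.empty)
    then obtain p where p: "p \<in> incremented u r" "p \<notin> decremented u r" by auto
    \<comment> \<open>A process decremented for \<open>r'\<close> is also incremented for
      \<open>r'\<close>. It carries only one increment, so \<open>r' = r\<close>, although
      \<open>p\<close> is pending for \<open>r\<close>.\<close>
    have "p \<notin> decremented u r'" for r'
    proof
      assume "p \<in> decremented u r'"
      then have r': "p \<in> incremented u r'" using decremented_subset[OF u(2)] by auto
      have "r' = r"
      proof -
        obtain i j where ij: "i < length u" "op (fst (u ! i)) = Incr r" "snd (u ! i) = p"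
          "j < length u" "op (fst (u ! j)) = Incr r'" "snd (u ! j) = p"
          using p(1) r' unfolding incremented_def by (auto simp: in_set_conv_nth)
        have "distinct (map snd (filter (\<lambda>x. is_incr (op (fst x))) u))"
          using admissibleD(1)[OF u(2)] by (simp add: consistent_def)
        then have "i = j" using ij unfolding distinct_map_filter_conv_nth is_incr_def by blast
        then show ?thesis using ij by simp
      qed
      then show False using p(2) \<open>p \<in> decremented u r'\<close> by simp
    qed
    then show ?thesis using Decr p(1) by auto
  next
    case (Zero r)
    then have "counters u r = 0" using s(2) u(3) by simp
    then show ?thesis using Zero by (simp add: counters_def)
  qed
  then obtain p where "admissible (u @ [(l, p)])" using edge u(2) by (auto simp: admissible_snoc)
  moreover from this have "exec (op l) s (counters (u @ [(l, p)]))"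
    using counters_snoc[of u l p] u(3) by simp
  \<comment> \<open>\<open>exec\<close> determines its final state, so the counters agree with the
    prescribed run.\<close>
  then have "counters (u @ [(l, p)]) = t" using s(2) by (cases "op l") auto
  ultimately show ?case using u(1) by (intro exI[of _ "u @ [(l, p)]"]) simp
qed

text \<open>If Environment never moves, System spells out a candidate run. Stopping after each
  prefix yields further plays that must satisfy the formula, and together they show that every step
  is legal.\<close>

lemma winning_imp_path:
  assumes S: "S \<in> strategies (set L) {0} P\<^sub>S P\<^sub>E"
    and win: "winning (set L) {0} P\<^sub>S P\<^sub>E S (Conj graph_formula (input_formula b cs))"
  shows "\<exists>ls t. successively E (b # cs @ ls) \<and> run (map op (b # cs @ ls)) (\<lambda>_. 0) t \<and>
    h \<in> set (b # cs @ ls)"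
proof -
  have sat: "sat P\<^sub>S P\<^sub>E w \<nu> graph_formula \<and> sat P\<^sub>S P\<^sub>E w \<nu> (input_formula b cs)"
    if "w \<in> data_words (set L) {0} P\<^sub>S P\<^sub>E" "compatible (set L) P\<^sub>S S w" "fair (set L) P\<^sub>S S w" for w \<nu>
    using win that unfolding winning_def models_def by simp
  obtain w where w: "w \<in> data_words (set L) {0} P\<^sub>S P\<^sub>E" "compatible (set L) P\<^sub>S S w" "fair (set L) P\<^sub>S S w"
    and sys: "\<And>i. i \<in> positions w \<Longrightarrow> letter_at w i \<in> set L \<times> P\<^sub>S"
    using play_extends[OF S, of "[]"] by (auto simp: follows_def)
  have letter: "fst (letter_at w i) \<in> set L" if "i \<in> positions w" for i
    using sys[OF that] by (simp add: mem_Times_iff)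
  have nonzero: "fst (letter_at w i) \<noteq> 0" if "i \<in> positions w" for i
    using letter[OF that] zero_notin by metis
  have "P\<^sub>E \<noteq> {} \<and> (\<exists>i \<in> positions w. fst (letter_at w i) = h)"
    using sat[OF w, of undefined] nonzero by (simp add: sat_graph_formula)
  then obtain n\<^sub>h p where h: "n\<^sub>h \<in> positions w" "fst (letter_at w n\<^sub>h) = h" and p: "p \<in> P\<^sub>E"
    by blast
  obtain k where k: "k \<in> positions w" "fst (letter_at w k) = b"
    "\<And>j. j < length cs \<Longrightarrow> Suc (k + j) \<in> positions w \<and> fst (letter_at w (Suc (k + j))) = cs ! j"
    using sat[OF w] nonzero by (auto simp: sat_input_formula)
  \<comment> \<open>Let Environment stop after \<open>n\<close> letters; System loses if it moves again.\<close>
  have prefix: "consistent (pref w n) \<and> zero_tested (pref w n)" if n: "{..<n} \<subseteq> positions w" for n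
  proof -
    let ?u = "pref w n"
    let ?v = "?u @ [(0, p)]"
    have u: "?u ! i = letter_at w i" "letter_at w i \<in> set L \<times> P\<^sub>S" if "i < n" for i
      using that sys[of i] n by auto
    have v: "?v ! i = letter_at w i" if "i < n" for i using that by (simp add: nth_append)
    have "set ?u \<subseteq> set L \<times> P\<^sub>S"
      using u(2) by (simp add: pref_def image_subset_iff)
    then have "?v \<in> lists (set L \<times> P\<^sub>S \<union> {0} \<times> P\<^sub>E)"
      using p by (simp add: in_lists_conv_set) blast
    \<comment> \<open>The stop letter is Environment's, so only the first \<open>n\<close> letters
      are constrained.\<close>
    moreover have "follows (set L) P\<^sub>S S ?v"
    proof -
      have "S (take i ?v) = Some (letter_at w i)" if "i < n" for i
        using w(2) that u(2)[OF that] n by (auto simp: compatible_def take_pref)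
      then show ?thesis unfolding follows_def using zero_notin
        by (auto simp: less_Suc_eq v) (simp add: nth_append)
    qed
    ultimately obtain w' where w': "w' \<in> data_words (set L) {0} P\<^sub>S P\<^sub>E" "compatible (set L) P\<^sub>S S w'"
      "fair (set L) P\<^sub>S S w'"
      "\<And>i. i < Suc n \<Longrightarrow> i \<in> positions w' \<and> letter_at w' i = ?v ! i"
      "\<And>i. i \<in> positions w' \<Longrightarrow> Suc n \<le> i \<Longrightarrow> letter_at w' i \<in> set L \<times> P\<^sub>S"
      using play_extends[OF S, of ?v] by auto
    have stop: "fst (letter_at w' i) = 0 \<longleftrightarrow> i = n" if "i \<in> positions w'" for i
    proof (cases i n rule: linorder_cases)
      case less
      then show ?thesis using w'(4)[of i] v nonzero n by auto
    next
      case equal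
      then show ?thesis using w'(4)[of i] by (simp add: nth_append)
    next
      case greater
      then have "fst (letter_at w' i) \<in> set L" using w'(5)[of i] that by (simp add: mem_Times_iff)
      then show ?thesis using greater zero_notin by (metis less_irrefl)
    qed
    \<comment> \<open>Exactly one stop occurs, so the escape \<open>two_stops\<close> is closed and
      no violation may hold.\<close>
    have viol: "\<not> (\<exists>\<phi> \<in> set violations. sat P\<^sub>S P\<^sub>E w' \<nu> \<phi>)" for \<nu>
      using sat[OF w'(1-3), of \<nu>] stop by (auto simp: sat_graph_formula)
    have "adjacent [0] L \<in> set violations" by (simp add: violations_def)
    then have late: "\<not> sat P\<^sub>S P\<^sub>E w' \<nu> (adjacent [0] L)" for \<nu> using viol by blast
    have last: "i \<le> n" if "i \<in> positions w'" for i
    proof (rule ccontr)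
      assume "\<not> i \<le> n"
      then have "Suc n \<in> positions w'" using that positions_downward_closed[of i w' "Suc n"] by simp
      moreover from this have "fst (letter_at w' (Suc n)) \<in> set L"
        using w'(5)[of "Suc n"] by (simp add: mem_Times_iff)
      moreover have "fst (letter_at w' n) = 0" using stop[of n] w'(4)[of n] by blast
      ultimately show False using late by (auto simp: sat_adjacent)
    qed
    have "(\<exists>\<phi> \<in> set violations. sat P\<^sub>S P\<^sub>E w' \<nu> \<phi>) \<longleftrightarrow>
        \<not> (consistent ?u \<and> (length ?u \<in> positions w' \<longrightarrow> zero_tested ?u))" for \<nu>
    proof (rule sat_violations)
      show "i \<in> positions w' \<and> letter_at w' i = ?u ! i \<and> fst (?u ! i) \<in> set L" if "i < length ?u" for i
        using that w'(4)[of i] letter n by (auto simp: nth_append)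
      show "i < length ?u \<or> i = length ?u \<and> fst (letter_at w' i) = 0" if "i \<in> positions w'" for i
        using last[OF that] stop[OF that] by auto
    qed
    then show ?thesis using viol w'(4)[of n] by simp
  qed
  have admissible: "admissible (pref w n)" if n: "{..<n} \<subseteq> positions w" for n
  proof -
    have "take m (pref w n) = pref w m" "{..<m} \<subseteq> positions w" if "m \<le> n" for m
      using that n by (auto simp: take_pref)
    then show ?thesis unfolding admissible_def using prefix by simp
  qed
  have down: "{..<Suc n} \<subseteq> positions w" if "n \<in> positions w" for n
    using positions_downward_closed[OF that] by auto
  \<comment> \<open>\<open>b\<close> is never the target of an edge, so the \<open>b\<close>
    supplied by the input formula is the first letter.\<close>
  have "k = 0"
  proof (rule ccontr)
    assume "k \<noteq> 0"
    then obtain k' where k': "k = Suc k'" by (cases k) auto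
    have "successively E (map fst (pref w (Suc k)))"
      using prefix[OF down[OF k(1)]] by (simp add: consistent_def)
    then have "E (fst (letter_at w k')) (fst (letter_at w k))"
      unfolding successively_conv_nth by (auto simp: k')
    then show False using edge k(2) by blast
  qed
  \<comment> \<open>This prefix is long enough to contain the halting letter and the complete
    input.\<close>
  define n where "n = Suc (max n\<^sub>h (length cs))"
  have "length cs \<in> positions w" using k \<open>k = 0\<close> by (cases "length cs") auto
  then have "max n\<^sub>h (length cs) \<in> positions w" using h(1) by (simp add: max_def)
  then have n: "{..<n} \<subseteq> positions w" unfolding n_def by (rule down)
  let ?u = "pref w n"
  have ls: "map fst ?u = b # cs @ map fst (drop (Suc (length cs)) ?u)"
  proof (rule nth_equalityI)
    fix i assume "i < length (map fst ?u)"
    then show "map fst ?u ! i = (b # cs @ map fst (drop (Suc (length cs)) ?u)) ! i"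
      using k \<open>k = 0\<close> by (auto simp: nth_Cons nth_append n_def split: nat.split)
  qed (simp add: n_def)
  have "successively E (map fst ?u)" using prefix[OF n] by (simp add: consistent_def)
  moreover have "run (map op (map fst ?u)) (\<lambda>_. 0) (counters ?u)"
    using run_counters[OF admissible[OF n]] by simp
  moreover have "h \<in> set (map fst ?u)"
  proof -
    have "n\<^sub>h < n" by (simp add: n_def)
    then show ?thesis using h(2) by (auto simp: pref_def)
  qed
  ultimately show ?thesis unfolding ls by blast
qed

text \<open>System owns the processes of the spelled run, Environment a single other one. System
  reproduces \<open>u\<close>; a stop letter leads off the prefixes of \<open>u\<close> and silences
  System for good.\<close>

lemma path_imp_part_synth:
  assumes path: "successively E (b # cs @ ls)" and run: "run (map op (b # cs @ ls)) (\<lambda>_. 0) t"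
    and h: "h \<in> set (b # cs @ ls)"
  shows "part_synth (set L) {0} (Conj graph_formula (input_formula b cs))"
proof -
  obtain u :: "(nat \<times> nat) list" where u: "map fst u = b # cs @ ls" "admissible u"
    using ex_admissible[OF path _ run] by (metis list.sel(1))
  have L: "fst (u ! i) \<in> set L" if "i < length u" for i
  proof (cases i)
    case 0
    then have "fst (u ! i) = map fst u ! 0" using that by simp
    then show ?thesis using b_in by (simp add: u(1))
  next
    case (Suc j)
    have "successively E (map fst u)" using path u(1) by simp
    then show ?thesis using that edge Suc unfolding successively_conv_nth by auto
  qed
  define P\<^sub>S where "P\<^sub>S = snd ` set u"
  obtain p where p: "p \<notin> P\<^sub>S" using ex_new_if_finite[of P\<^sub>S] by (auto simp: P\<^sub>S_def)
  have sys: "u ! i \<in> set L \<times> P\<^sub>S" if "i < length u" for i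
    using L[OF that] nth_mem[OF that] by (auto simp: P\<^sub>S_def mem_Times_iff)
  define S :: "(nat, nat) strategy" where
    "S v = (if length v < length u \<and> v = take (length v) u then Some (u ! length v) else None)" for v
  have S: "S \<in> strategies (set L) {0} P\<^sub>S {p}" using sys by (auto simp: strategies_def S_def)
  have "winning (set L) {0} P\<^sub>S {p} S (Conj graph_formula (input_formula b cs))"
    unfolding winning_def
  proof (intro ballI impI)
    fix w assume w: "w \<in> data_words (set L) {0} P\<^sub>S {p}" and "compatible (set L) P\<^sub>S S w \<and> fair (set L) P\<^sub>S S w"
    then have comp: "compatible (set L) P\<^sub>S S w" by simp
    have step: "i < length u \<and> pref w i = take i u \<and> letter_at w i = u ! i"
      if "i \<in> positions w" "fst (letter_at w i) \<noteq> 0" for i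
    proof -
      have "letter_at w i \<in> set L \<times> P\<^sub>S" using w that by (auto simp: data_words_def)
      then have "S (pref w i) = Some (letter_at w i)" using comp that(1) by (simp add: compatible_def)
      then show ?thesis by (auto simp: S_def split: if_splits)
    qed
    have after: "Suc i \<notin> positions w \<or> fst (letter_at w (Suc i)) = 0"
      if "i \<in> positions w" "fst (letter_at w i) = 0" for i
    proof (rule ccontr)
      assume "\<not> ?thesis"
      then have "pref w (Suc i) = take (Suc i) u" "Suc i < length u" using step[of "Suc i"] by auto
      then have "letter_at w i = u ! i" using nth_pref[of i "Suc i" w] by simp
      then show False using L[of i] that(2) zero_notin \<open>Suc i < length u\<close> by auto
    qed
    have prefix: "consistent (take n u)" "zero_tested (take n u)" for n
      by (rule admissibleD[OF admissible_take[OF u(2)]])+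
    consider (two) i j where "i \<in> positions w" "j \<in> positions w" "i \<noteq> j"
        "fst (letter_at w i) = 0" "fst (letter_at w j) = 0"
      | (one) i where "i \<in> positions w" "fst (letter_at w i) = 0"
        "\<And>j. j \<in> positions w \<Longrightarrow> fst (letter_at w j) = 0 \<Longrightarrow> j = i"
      | (none) "\<And>j. j \<in> positions w \<Longrightarrow> fst (letter_at w j) \<noteq> 0" by metis
    then show "models P\<^sub>S {p} w (Conj graph_formula (input_formula b cs))"
    proof cases
      case two
      then show ?thesis by (auto simp: models_def sat_graph_formula sat_input_formula)
    next
      case one
      have last: "j \<le> i" if "j \<in> positions w" for j
      proof (rule ccontr)
        assume "\<not> j \<le> i"
        then have "Suc i \<in> positions w" using positions_downward_closed[OF that, of "Suc i"] by simp
        then show False using after[OF one(1,2)] one(3)[of "Suc i"] by auto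
      qed
      have before: "j \<in> positions w \<and> j < length u \<and> letter_at w j = u ! j" if "j < i" for j
        using positions_downward_closed[OF one(1), of j] step[of j] one(3)[of j] that by auto
      have len: "length (take i u) = i"
        using before[of "i - 1"] by (cases i) auto
      have "(\<exists>\<phi> \<in> set violations. sat P\<^sub>S {p} w \<nu> \<phi>) \<longleftrightarrow>
          \<not> (consistent (take i u) \<and> (length (take i u) \<in> positions w \<longrightarrow> zero_tested (take i u)))" for \<nu>
      proof (rule sat_violations)
        show "j \<in> positions w \<and> letter_at w j = take i u ! j \<and> fst (take i u ! j) \<in> set L"
          if "j < length (take i u)" for j
          using before[of j] L[of j] that len by simp
        show "j < length (take i u) \<or> j = length (take i u) \<and> fst (letter_at w j) = 0"
          if "j \<in> positions w" for j
          using last[OF that] one(2) unfolding len by auto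
      qed
      then have "\<not> (\<exists>\<phi> \<in> set violations. sat P\<^sub>S {p} w \<nu> \<phi>)" for \<nu> using prefix by simp
      then show ?thesis using one(1,2) by (auto simp: models_def sat_graph_formula sat_input_formula)
    next
      case none
      have w_u: "j < length u \<and> letter_at w j = u ! j" if "j \<in> positions w" for j
        using step[of j] none that by auto
      obtain v where v: "w = FinSeq v"
        using w_u[of "length u"] by (cases w) auto
      have pos: "v ! j = u ! j" "j < length u" if "j < length v" for j using w_u[of j] that v by auto
      have "length v \<le> length u" using pos(2)[of "length u"] by (meson not_le_imp_less less_irrefl)
      then have "v = take (length v) u" using pos by (intro nth_equalityI) auto
      moreover have "S v = None" using comp v by (simp add: compatible_def)
      \<comment> \<open>A finite play ends only when System passes, and on prefixes of
        \<open>u\<close> it passes only at the end.\<close>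
      ultimately have "length u \<le> length v" by (auto simp: S_def split: if_splits)
      with \<open>v = take (length v) u\<close> have vu: "v = u" by simp
      have "(\<exists>\<phi> \<in> set violations. sat P\<^sub>S {p} w \<nu> \<phi>) \<longleftrightarrow>
          \<not> (consistent u \<and> (length u \<in> positions w \<longrightarrow> zero_tested u))" for \<nu>
        by (rule sat_violations) (use L v vu in auto)
      then have viol: "\<not> (\<exists>\<phi> \<in> set violations. sat P\<^sub>S {p} w \<nu> \<phi>)" for \<nu>
        using prefix[of "length u"] by simp
      have len: "length u = Suc (length cs + length ls)" using arg_cong[OF u(1), of length] by simp
      have nth: "fst (u ! j) = (b # cs @ ls) ! j" if "j < length u" for j
        using that u(1) by (metis nth_map)
      have "\<exists>j < length u. fst (u ! j) = h"
        using h unfolding u(1)[symmetric] in_set_conv_nth by auto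
      moreover have "0 < length u \<and> fst (u ! 0) = b \<and>
          (\<forall>j < length cs. Suc j < length u \<and> fst (u ! Suc j) = cs ! j)"
        using nth len by (auto simp: nth_append)
      ultimately show ?thesis using viol
        by (auto simp: models_def sat_graph_formula sat_input_formula v vu)
    qed
  qed
  moreover have "finite P\<^sub>S" by (simp add: P\<^sub>S_def)
  ultimately show ?thesis unfolding part_synth_def using S p
    by (intro exI[of _ P\<^sub>S] exI[of _ "{p}"]) auto
qed

lemma part_synth_iff_path:
  "part_synth (set L) {0} (Conj graph_formula (input_formula b cs)) \<longleftrightarrow>
    (\<exists>ls t. successively E (b # cs @ ls) \<and> run (map op (b # cs @ ls)) (\<lambda>_. 0) t \<and>
      h \<in> set (b # cs @ ls))"
proof
  assume "part_synth (set L) {0} (Conj graph_formula (input_formula b cs))"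
  then obtain P\<^sub>S P\<^sub>E :: "nat set" and S where "S \<in> strategies (set L) {0} P\<^sub>S P\<^sub>E"
    "winning (set L) {0} P\<^sub>S P\<^sub>E S (Conj graph_formula (input_formula b cs))"
    unfolding part_synth_def by metis
  then show "\<exists>ls t. successively E (b # cs @ ls) \<and> run (map op (b # cs @ ls)) (\<lambda>_. 0) t \<and>
      h \<in> set (b # cs @ ls)"
    by (rule winning_imp_path)
qed (elim exE conjE, rule path_imp_part_synth)

end

section \<open>Diagonalisation\<close>

text \<open>The effect on codes of prefixing one letter in \<open>letters_after\<close>;
  \<open>x\<close> is the code for the remaining letters, and the numerals are connective tags and
  variable codes.\<close>

definition encode_step :: "nat \<Rightarrow> nat \<Rightarrow> nat" where
  "encode_step l x = prod_encode (10, prod_encode (1, prod_encode (8, prod_encode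
     (fo2_encode (Conj (Suc_of Vy Vx) (Act l Vy)), prod_encode (10, prod_encode (0,
       prod_encode (8, prod_encode (fo2_encode (Eq Vx Vy), x))))))))"

lemma encode_letters_after_Cons:
  "fo2_encode (letters_after (l # ls)) = encode_step l (fo2_encode (letters_after ls))"
  by (simp add: encode_step_def)

lemma encode_letters_after_replicate:
  "fo2_encode (letters_after (replicate n l @ ls)) = (encode_step l ^^ n) (fo2_encode (letters_after ls))"
  by (induction n) (simp_all add: encode_letters_after_Cons del: letters_after.simps fo2_encode.simps)

lemma computable_encode_step: "computable k F \<Longrightarrow> computable k (\<lambda>xs. encode_step l (F xs))"
  unfolding encode_step_def by (intro computable_prod_encode computable_const)

lemma encode_input_formula:
  "fo2_encode (input_formula b cs) = prod_encode (9, prod_encode (fo2_encode stopped,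
     prod_encode (10, prod_encode (0, prod_encode (8, prod_encode
       (fo2_encode (any_of [b] Vx), fo2_encode (letters_after cs)))))))"
  by (simp add: input_formula_def some_at_def)

text \<open>Each argument is used twice, as a code inside the instance and as a number of input
  letters. This is the self-reference of the diagonal argument; the tag 8 is that of
  \<open>Conj\<close>.\<close>

lemma computable_instance:
  "computable 2 (\<lambda>xs. prod_encode (xs ! 0, prod_encode (set_encode {0}, prod_encode (8,
     prod_encode (xs ! 1, fo2_encode (input_formula b (input_letters (xs ! 0) (xs ! 1))))))))"
proof -
  have "computable 2 (\<lambda>xs. fo2_encode (letters_after (input_letters (xs ! 0) (xs ! 1))))"
    unfolding input_letters_def encode_letters_after_replicate
    by (intro computable_funpow computable_encode_step computable_const computable_proj) simp_all
  then show ?thesis unfolding encode_input_formula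
    by (intro computable_prod_encode computable_const computable_proj) simp_all
qed

lemma ex_register_bound:
  "\<exists>R. \<forall>l \<in> set ls. \<forall>r. op l \<in> {Incr r, Decr r, Zero r} \<longrightarrow> r < (R :: nat)"
proof (induction ls)
  case (Cons l ls)
  then obtain R where "\<forall>l \<in> set ls. \<forall>r. op l \<in> {Incr r, Decr r, Zero r} \<longrightarrow> r < R" by blast
  moreover obtain R' where "\<forall>r. op l \<in> {Incr r, Decr r, Zero r} \<longrightarrow> r < R'"
    by (cases "op l") auto
  ultimately show ?case by (intro exI[of _ "max R R'"]) (auto simp: less_max_iff_disj)
qed simp

text \<open>\<open>\<phi>\<close> is obtained from \<open>P\<close> before \<open>a\<close> and
  \<open>c\<close> are chosen, so its own code can later be taken as the input
  \<open>c\<close>.\<close>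

lemma ex_graph_formula:
  obtains \<phi> where "\<And>a c. (set [1..<6 + 2 * length P], {0}, Conj \<phi> (input_formula 1 (input_letters a c))) \<in> instances"
    "\<And>a c. part_synth (set [1..<6 + 2 * length P]) {0} (Conj \<phi> (input_formula 1 (input_letters a c)))
      \<longleftrightarrow> halts P 0 ((\<lambda>_. 0)(0 := a, 1 := c))"
proof -
  let ?L = "[1..<6 + 2 * length P]"
  obtain R where R: "\<And>l r. l \<in> set ?L \<Longrightarrow> letter_op P l \<in> {Incr r, Decr r, Zero r} \<Longrightarrow> r < R"
    using ex_register_bound[of ?L "letter_op P"] by blast
  interpret counter_graph ?L "letter_op P" "edge P" 1 5 R
    by unfold_locales (use R in \<open>auto simp del: insert_iff dest: edge_letter\<close>)
  show ?thesis
  proof (rule that)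
    fix a c
    have "Conj graph_formula (input_formula 1 (input_letters a c)) \<in> sentences (set ?L \<union> {0})"
      by (rule graph_formula_sentence) (auto simp: input_letters_def)
    then show "(set ?L, {0}, Conj graph_formula (input_formula 1 (input_letters a c))) \<in> instances"
      by (simp add: instances_def)
    show "part_synth (set ?L) {0} (Conj graph_formula (input_formula 1 (input_letters a c)))
      \<longleftrightarrow> halts P 0 ((\<lambda>_. 0)(0 := a, 1 := c))"
      unfolding part_synth_iff_path path_iff_halts ..
  qed
qed

theorem theorem4: "\<not> decidable inst_encode instances PartSynth"
proof
  assume "decidable inst_encode instances PartSynth"
  then obtain d where d: "\<And>i. i \<in> instances \<Longrightarrow> rec_eval d [inst_encode i] (if i \<in> PartSynth then 1 else 0)"
    unfolding decidable_def by blast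
  obtain g where g: "\<And>a c. rec_eval g [a, c] (prod_encode (a, prod_encode (set_encode {0}, prod_encode (8,
      prod_encode (c, fo2_encode (input_formula 1 (input_letters a c)))))))"
    using computable_instance[of 1] unfolding computable_def
    by (metis (no_types, lifting) length_Cons list.size(3) nth_Cons_0 nth_Cons_Suc numeral_2_eq_2 One_nat_def)
  \<comment> \<open>\<open>P\<close> applies the supposed decision procedure to the instance
    assembled from its inputs and halts exactly when the answer is 0.\<close>
  obtain P where P: "\<And>s y. \<forall>j \<ge> 2. s j = 0 \<Longrightarrow> rec_eval (Comp d [g]) (map s [0..<2]) y \<Longrightarrow>
      halts P 0 s \<longleftrightarrow> y = 0"
    using ex_halting_program[of 2 "Comp d [g]"] by blast
  let ?A = "set [1..<6 + 2 * length P]"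
  obtain \<phi> where \<phi>: "\<And>a c. (?A, {0}, Conj \<phi> (input_formula 1 (input_letters a c))) \<in> instances"
    "\<And>a c. part_synth ?A {0} (Conj \<phi> (input_formula 1 (input_letters a c)))
      \<longleftrightarrow> halts P 0 ((\<lambda>_. 0)(0 := a, 1 := c))"
    using ex_graph_formula[of P] by blast
  \<comment> \<open>The inputs are the codes of the alphabet and the formula belonging to
    \<open>P\<close> itself, so the instance assembled by \<open>g\<close> is
    \<open>?i\<close>.\<close>
  define a c where "a = set_encode ?A" and "c = fo2_encode \<phi>"
  let ?i = "(?A, {0}, Conj \<phi> (input_formula 1 (input_letters a c)))"
  let ?s = "(\<lambda>_. 0)(0 := a, 1 := c)"
  have "rec_eval g [a, c] (inst_encode ?i)"
    using g[of a c] by (simp only: inst_encode.simps fo2_encode.simps a_def c_def)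
  then have "rec_eval (Comp d [g]) [a, c] (if ?i \<in> PartSynth then 1 else 0)"
    using d[OF \<phi>(1)] by (intro eval_Comp[where ys = "[inst_encode ?i]"]) auto
  moreover have "map ?s [0..<2] = [a, c]" by (simp add: numeral_2_eq_2)
  ultimately have "halts P 0 ?s \<longleftrightarrow> ?i \<notin> PartSynth"
    using P[of ?s "if ?i \<in> PartSynth then 1 else 0"] by simp
  moreover have "?i \<in> PartSynth \<longleftrightarrow> halts P 0 ?s"
    unfolding PartSynth_def using \<phi> by simp
  ultimately show False by blast
qed

end
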